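(* The Wagner graph $V_8$ admits no generalized cycle system consisting of circuits, but $(M(V_8),B_0)$ carries a fibre system, where $B_0$ is the canonical tree of the dominating path $1\,0\,7$. Hence Stanley's conjecture holds for $V_8$: for such a fibre system $F$ the set $\mathcal P^*(F)$ of relaxed coparking functions is an explicit pure multicomplex with degree sequence $h(M(V_8))$.
   Context: The Wagner graph $V_8$ has vertices $0,\dots,7$ and edges the $8$-cycle $0\,1\,2\,3\,4\,5\,6\,7$ together with the four diagonals $v(v+4)$, $v=0,1,2,3$. The canonical tree of the dominating path $1\,0\,7$ attaches every vertex to $0$ if possible, else to $1$, else to $7$: $B_0=\{01,04,07,12,15,76,73\}$, with complement $R=\{23,34,45,56,26\}$. For a matroid $M$ of corank $g$ (here $M=M(V_8)$ is the graphic matroid, $g=5$), a generalized cycle system is a collection $\{C_1,\dots,C_g\}$ of cycles (unions of circuits) of $M$ such that for every nonempty $S\subseteq[g]$ the set of elements lying in exactly one $C_i$ with $i\in S$ is either dependent or a basis of $M|\bigcup_{i\in S}C_i$. It consists of circuits if each $C_i$ is a circuit. With $M=M(V_8)$ and basis $B_0$: for $i\in R$, $C_i$ is the fundamental circuit, the unique circuit in $B_0\cup\{i\}$. For $\sigma\subseteq R$ put $m_\sigma(e)=\#\{i\in\sigma:e\in C_i\}$, $U_\sigma=\{e:m_\sigma(e)=1\}$, $A_\sigma=\{e:m_\sigma(e)\ge1\}$. A stratum is a nonempty $\sigma\subseteq R$; it is dead if $U_\sigma$ is independent in $M$ (a forest), live otherwise. The baseline $b_\sigma\in\mathbb N^\sigma$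 is $b_\sigma(i)=|C_i\cap U_\sigma|$; $\mathbb N^\sigma$ is identified with the vectors in $\mathbb N^R$ vanishing outside $\sigma$. $\sigma$ can be fired from $a\in\mathbb N^R$ if $a_i\ge b_\sigma(i)$ for all $i\in\sigma$. For dead $\sigma$, $K_\sigma=(M|A_\sigma)/U_\sigma$. For a matroid $N$ of rank $d$, $h(N)=(h_0,\dots,h_d)$ is the $h$-vector of its independence complex: $T_N(x,1)=\sum_kh_kx^{d-k}$. A multicomplex is a finite set of monomials (exponent vectors) closed under division; it is pure if all maximal elements have the same degree $|a|=\sum a_i$; its degree sequence counts elements of each degree (trailing zeros ignored). Stanley's conjecture for $M$ says that $h(M)$ is the degree sequence of a pure multicomplex. Fibres (recursively along inclusion): given fibres $F(\tau)$ at all dead $\tau\subsetneq\sigma$, a fibre at a dead stratum $\sigma$ is a set $F(\sigma)\subseteq\mathbb N^\sigma$ such that (i) $F(\sigma)$ is a pure multicomplex with degree sequence $h(K_\sigma)$; (ii) for every $m\in F(\sigma)$, every stratum $\tau\subsetneq\sigma$ that can be fired from $b_\sigma+m$ is dead with $(b_\sigma+m)|_\tau-b_\tau\in F(\tau)$. A fibre system $F$ is a choice of a fibre at every dead stratum. $\mathcal P^*(F)$ is the set of $a\in\mathbb N^R$ such that every stratum $\tau$ that can be fired from $a$ is dead with $a|_\tau-b_\tau\in F(\tau)$. *)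

theory Defs
  imports "HOL-Computational_Algebra.Polynomial"
begin

section \<open>Matroids\<close>

text \<open>The record holds the data of a matroid only, not its axioms: the notions below are applied to
  graphic matroids of finite graphs and to their minors.\<close>

record 'e matroid =
  ground :: "'e set"
  indep :: "'e set \<Rightarrow> bool"

definition basis :: "'e matroid \<Rightarrow> 'e set \<Rightarrow> bool" where
  "basis M J \<longleftrightarrow> indep M J \<and> (\<forall>J'. indep M J' \<and> J \<subseteq> J' \<longrightarrow> J' = J)"

definition dependent :: "'e matroid \<Rightarrow> 'e set \<Rightarrow> bool" where
  "dependent M D \<longleftrightarrow> D \<subseteq> ground M \<and> \<not> indep M D"

definition circuit :: "'e matroid \<Rightarrow> 'e set \<Rightarrow> bool" where
  "circuit M C \<longleftrightarrow> dependent M C \<and> (\<forall>D. D \<subset> C \<longrightarrow> \<not> dependent M D)"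

definition rk :: "'e matroid \<Rightarrow> 'e set \<Rightarrow> nat" where
  "rk M X = Max (card ` {J. J \<subseteq> X \<and> indep M J})"

abbreviation rank_of :: "'e matroid \<Rightarrow> nat" where
  "rank_of M \<equiv> rk M (ground M)"

definition corank :: "'e matroid \<Rightarrow> nat" where
  "corank M = card (ground M) - rank_of M"

definition restriction :: "'e matroid \<Rightarrow> 'e set \<Rightarrow> 'e matroid" where
  "restriction M X = \<lparr>ground = ground M \<inter> X, indep = (\<lambda>J. J \<subseteq> X \<and> indep M J)\<rparr>"

definition contraction :: "'e matroid \<Rightarrow> 'e set \<Rightarrow> 'e matroid" where
  "contraction M T = \<lparr>ground = ground M - T,
     indep = (\<lambda>J. J \<subseteq> ground M - T \<and> (\<exists>K. basis (restriction M T) K \<and> indep M (J \<union> K)))\<rparr>"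

definition tutte :: "'e matroid \<Rightarrow> 'r::comm_ring_1 \<Rightarrow> 'r \<Rightarrow> 'r" where
  "tutte M x y =
     (\<Sum>X\<in>Pow (ground M). (x - 1) ^ (rank_of M - rk M X) * (y - 1) ^ (card X - rk M X))"

text \<open>\<open>T\<^sub>M(x, 1)\<close> is the Tutte polynomial evaluated in \<open>\<int>[x]\<close> at the indeterminate \<open>[:0, 1:]\<close> and
  at \<open>1\<close>.  The \<open>h\<close>-vector is continued by zeros beyond the rank.\<close>

definition h_vector :: "'e matroid \<Rightarrow> nat \<Rightarrow> int" where
  "h_vector M k =
     (if k \<le> rank_of M then coeff (tutte M [:0, 1:] (1 :: int poly)) (rank_of M - k) else 0)"


section \<open>Multicomplexes and Stanley's conjecture\<close>

text \<open>A monomial in variables indexed by the finite set \<open>I\<close> is an exponent vector of type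
  \<open>'i \<Rightarrow> nat\<close> vanishing outside \<open>I\<close>; divisibility is the pointwise order on functions.\<close>

definition exponents :: "'i set \<Rightarrow> ('i \<Rightarrow> nat) set" where
  "exponents I = {a. \<forall>i. i \<notin> I \<longrightarrow> a i = 0}"

definition multicomplex :: "'i set \<Rightarrow> ('i \<Rightarrow> nat) set \<Rightarrow> bool" where
  "multicomplex I P \<longleftrightarrow> finite P \<and> P \<subseteq> exponents I \<and> (\<forall>a\<in>P. \<forall>b. b \<le> a \<longrightarrow> b \<in> P)"

definition maximal_in :: "('i \<Rightarrow> nat) set \<Rightarrow> ('i \<Rightarrow> nat) \<Rightarrow> bool" where
  "maximal_in P a \<longleftrightarrow> a \<in> P \<and> (\<forall>b\<in>P. a \<le> b \<longrightarrow> b = a)"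

definition pure_multicomplex :: "'i set \<Rightarrow> ('i \<Rightarrow> nat) set \<Rightarrow> bool" where
  "pure_multicomplex I P \<longleftrightarrow> multicomplex I P \<and>
     (\<forall>a b. maximal_in P a \<and> maximal_in P b \<longrightarrow> sum a I = sum b I)"

definition has_degree_sequence :: "'i set \<Rightarrow> ('i \<Rightarrow> nat) set \<Rightarrow> (nat \<Rightarrow> int) \<Rightarrow> bool" where
  "has_degree_sequence I P h \<longleftrightarrow> (\<forall>k. int (card {a \<in> P. sum a I = k}) = h k)"

definition stanley_conjecture_for :: "'e matroid \<Rightarrow> bool" where
  "stanley_conjecture_for M \<longleftrightarrow>
     (\<exists>(n::nat) P. pure_multicomplex {..<n} P \<and> has_degree_sequence {..<n} P (h_vector M))"


section \<open>Generalized cycle systems\<close>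

definition multiplicity_in :: "('i \<Rightarrow> 'e set) \<Rightarrow> 'i set \<Rightarrow> 'e \<Rightarrow> nat" where
  "multiplicity_in C S e = card {i \<in> S. e \<in> C i}"

definition exactly_once :: "('i \<Rightarrow> 'e set) \<Rightarrow> 'i set \<Rightarrow> 'e set" where
  "exactly_once C S = {e. multiplicity_in C S e = 1}"

text \<open>The empty set is not counted as a cycle: otherwise the constant family \<open>\<emptyset>\<close> would always be a
  generalized cycle system.\<close>

definition cycle_of :: "'e matroid \<Rightarrow> 'e set \<Rightarrow> bool" where
  "cycle_of M Z \<longleftrightarrow> (\<exists>\<C>. \<C> \<noteq> {} \<and> (\<forall>C\<in>\<C>. circuit M C) \<and> Z = \<Union>\<C>)"

text \<open>A collection \<open>{C\<^sub>1, \<dots>, C\<^sub>g}\<close> is a family \<open>C\<close>, of which only the values on \<open>{1..g}\<close> matter.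
  Such a family has no repetitions: \<open>C\<^sub>i = C\<^sub>j\<close> with \<open>i \<noteq> j\<close> violates the condition for \<open>S = {i, j}\<close>,
  because no element lies in exactly one of the two and \<open>\<emptyset>\<close> is not a basis of the
  restriction to \<open>C\<^sub>i\<close> when \<open>M\<close> has no loops.\<close>

definition generalized_cycle_system :: "'e matroid \<Rightarrow> (nat \<Rightarrow> 'e set) \<Rightarrow> bool" where
  "generalized_cycle_system M C \<longleftrightarrow>
     (\<forall>i\<in>{1..corank M}. cycle_of M (C i)) \<and>
     (\<forall>S. S \<noteq> {} \<and> S \<subseteq> {1..corank M} \<longrightarrow>
        dependent M (exactly_once C S) \<or>
        basis (restriction M (\<Union>i\<in>S. C i)) (exactly_once C S))"

definition consists_of_circuits :: "'e matroid \<Rightarrow> (nat \<Rightarrow> 'e set) \<Rightarrow> bool" where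
  "consists_of_circuits M C \<longleftrightarrow> (\<forall>i\<in>{1..corank M}. circuit M (C i))"


section \<open>Strata and fibre systems\<close>

text \<open>Throughout, \<open>M\<close> is a matroid and \<open>B\<close> a basis of it.\<close>

definition fundamental_circuit :: "'e matroid \<Rightarrow> 'e set \<Rightarrow> 'e \<Rightarrow> 'e set" where
  "fundamental_circuit M B i = (THE C. circuit M C \<and> C \<subseteq> insert i B)"

definition cobasis :: "'e matroid \<Rightarrow> 'e set \<Rightarrow> 'e set" where
  "cobasis M B = ground M - B"

definition U_set :: "'e matroid \<Rightarrow> 'e set \<Rightarrow> 'e set \<Rightarrow> 'e set" where
  "U_set M B \<sigma> = exactly_once (fundamental_circuit M B) \<sigma>"

definition A_set :: "'e matroid \<Rightarrow> 'e set \<Rightarrow> 'e set \<Rightarrow> 'e set" where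
  "A_set M B \<sigma> = {e. multiplicity_in (fundamental_circuit M B) \<sigma> e \<ge> 1}"

definition stratum :: "'e matroid \<Rightarrow> 'e set \<Rightarrow> 'e set \<Rightarrow> bool" where
  "stratum M B \<sigma> \<longleftrightarrow> \<sigma> \<noteq> {} \<and> \<sigma> \<subseteq> cobasis M B"

definition dead :: "'e matroid \<Rightarrow> 'e set \<Rightarrow> 'e set \<Rightarrow> bool" where
  "dead M B \<sigma> \<longleftrightarrow> indep M (U_set M B \<sigma>)"

definition baseline :: "'e matroid \<Rightarrow> 'e set \<Rightarrow> 'e set \<Rightarrow> 'e \<Rightarrow> nat" where
  "baseline M B \<sigma> i = (if i \<in> \<sigma> then card (fundamental_circuit M B i \<inter> U_set M B \<sigma>) else 0)"

definition can_fire :: "'e matroid \<Rightarrow> 'e set \<Rightarrow> ('e \<Rightarrow> nat) \<Rightarrow> 'e set \<Rightarrow> bool" where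
  "can_fire M B a \<sigma> \<longleftrightarrow> (\<forall>i\<in>\<sigma>. baseline M B \<sigma> i \<le> a i)"

definition K_matroid :: "'e matroid \<Rightarrow> 'e set \<Rightarrow> 'e set \<Rightarrow> 'e matroid" where
  "K_matroid M B \<sigma> = contraction (restriction M (A_set M B \<sigma>)) (U_set M B \<sigma>)"

text \<open>The vector \<open>a|\<^sub>\<tau> - b\<^sub>\<tau>\<close>.  It is only used when \<open>\<tau>\<close> can be fired from \<open>a\<close>, so that no
  subtraction is truncated.\<close>

definition residue :: "'e matroid \<Rightarrow> 'e set \<Rightarrow> ('e \<Rightarrow> nat) \<Rightarrow> 'e set \<Rightarrow> 'e \<Rightarrow> nat" where
  "residue M B a \<tau> i = (if i \<in> \<tau> then a i - baseline M B \<tau> i else 0)"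

text \<open>A choice of fibres is a function \<open>F\<close> on all sets; only its values at dead strata matter.
  The condition at \<open>\<sigma>\<close> refers to \<open>F\<close> at dead \<open>\<tau> \<subset> \<sigma>\<close> only, so the recursion along inclusion
  becomes the requirement that the condition hold at every dead stratum.\<close>

definition fibre_at :: "'e matroid \<Rightarrow> 'e set \<Rightarrow> ('e set \<Rightarrow> ('e \<Rightarrow> nat) set) \<Rightarrow> 'e set \<Rightarrow> bool" where
  "fibre_at M B F \<sigma> \<longleftrightarrow>
     pure_multicomplex \<sigma> (F \<sigma>) \<and> has_degree_sequence \<sigma> (F \<sigma>) (h_vector (K_matroid M B \<sigma>)) \<and>
     (\<forall>m\<in>F \<sigma>. \<forall>\<tau>. stratum M B \<tau> \<and> \<tau> \<subset> \<sigma> \<and> can_fire M B (\<lambda>i. baseline M B \<sigma> i + m i) \<tau> \<longrightarrow>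
        dead M B \<tau> \<and> residue M B (\<lambda>i. baseline M B \<sigma> i + m i) \<tau> \<in> F \<tau>)"

definition fibre_system :: "'e matroid \<Rightarrow> 'e set \<Rightarrow> ('e set \<Rightarrow> ('e \<Rightarrow> nat) set) \<Rightarrow> bool" where
  "fibre_system M B F \<longleftrightarrow> (\<forall>\<sigma>. stratum M B \<sigma> \<and> dead M B \<sigma> \<longrightarrow> fibre_at M B F \<sigma>)"

definition relaxed_coparking ::
    "'e matroid \<Rightarrow> 'e set \<Rightarrow> ('e set \<Rightarrow> ('e \<Rightarrow> nat) set) \<Rightarrow> ('e \<Rightarrow> nat) set" where
  "relaxed_coparking M B F =
     {a \<in> exponents (cobasis M B).
        \<forall>\<tau>. stratum M B \<tau> \<and> can_fire M B a \<tau> \<longrightarrow> dead M B \<tau> \<and> residue M B a \<tau> \<in> F \<tau>}"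


section \<open>The graphic matroid of the Wagner graph\<close>

text \<open>Simple graphs, with edges as two-element sets of vertices.\<close>

record 'v sgraph =
  verts :: "'v set"
  edges :: "'v set set"

definition polygon :: "'v list \<Rightarrow> 'v set set" where
  "polygon vs = {{vs ! i, vs ! (Suc i mod length vs)} | i. i < length vs}"

definition forest :: "'v sgraph \<Rightarrow> 'v set set \<Rightarrow> bool" where
  "forest G X \<longleftrightarrow> X \<subseteq> edges G \<and> \<not> (\<exists>vs. distinct vs \<and> length vs \<ge> 3 \<and> polygon vs \<subseteq> X)"

definition graphic_matroid :: "'v sgraph \<Rightarrow> 'v set matroid" where
  "graphic_matroid G = \<lparr>ground = edges G, indep = forest G\<rparr>"

definition wagner :: "nat sgraph" where
  "wagner = \<lparr>verts = {0..7},
     edges = {{v, (v + 1) mod 8} | v. v \<le> 7} \<union> {{v, v + 4} | v. v \<le> 3}\<rparr>"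

text \<open>The canonical tree of a dominating path \<open>u c w\<close>: every vertex other than \<open>c\<close> is attached to
  the first of \<open>c\<close>, \<open>u\<close>, \<open>w\<close> adjacent to it; in particular \<open>u\<close> and \<open>w\<close> are attached to \<open>c\<close>.\<close>

definition canonical_tree :: "'v sgraph \<Rightarrow> 'v \<Rightarrow> 'v \<Rightarrow> 'v \<Rightarrow> 'v set set" where
  "canonical_tree G u c w =
     (\<lambda>v. if {v, c} \<in> edges G then {v, c} else if {v, u} \<in> edges G then {v, u} else {v, w})
       ` (verts G - {c})"

lemma edges_wagner:
  "edges wagner = {{0,1}, {1,2}, {2,3}, {3,4}, {4,5}, {5,6}, {6,7}, {7,0},
                   {0,4}, {1,5}, {2,6}, {3,7}}"
proof -
  have "{{v, (v + 1) mod 8} | v. v \<le> (7::nat)} = (\<lambda>v. {v, (v + 1) mod 8}) ` {0,1,2,3,4,5,6,7}"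
  proof -
    have "{v. v \<le> (7::nat)} = {0,1,2,3,4,5,6,7}" by auto
    then show ?thesis by (metis setcompr_eq_image)
  qed
  moreover have "{{v, v + 4} | v. v \<le> (3::nat)} = (\<lambda>v. {v, v + 4}) ` {0,1,2,3}"
  proof -
    have "{v. v \<le> (3::nat)} = {0,1,2,3}" by auto
    then show ?thesis by (metis setcompr_eq_image)
  qed
  moreover have "(\<lambda>v. {v, (v + 1) mod 8}) ` {0,1,2,3,4,5,6,7::nat} =
      {{0,1}, {1,2}, {2,3}, {3,4}, {4,5}, {5,6}, {6,7}, {7,0}}"
    by (simp add: Suc_eq_plus1 del: One_nat_def Suc_eq_plus1_left add_Suc_right)
  moreover have "(\<lambda>v. {v, v + 4}) ` {0,1,2,3::nat} = {{0,4}, {1,5}, {2,6}, {3,7}}"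
    by simp
  ultimately show ?thesis
    by (simp only: wagner_def sgraph.simps Un_insert_left Un_empty_left)
qed

lemma canonical_tree_wagner:
  "canonical_tree wagner 1 0 7 = {{0,1}, {0,4}, {0,7}, {1,2}, {1,5}, {7,6}, {7,3}}"
proof -
  have V: "verts wagner - {0} = {1,2,3,4,5,6,7}"
    unfolding wagner_def by auto
  have 0: "{v, 0} \<in> edges wagner \<longleftrightarrow> v = 1 \<or> v = 7 \<or> v = 4" for v
    unfolding edges_wagner insert_iff doubleton_eq_iff by simp
  have 1: "{v, 1} \<in> edges wagner \<longleftrightarrow> v = 0 \<or> v = 2 \<or> v = 5" for v
    unfolding edges_wagner insert_iff doubleton_eq_iff by simp
  have "canonical_tree wagner 1 0 7 = {{1,0}, {2,1}, {3,7}, {4,0}, {5,1}, {6,7}, {7,0}}"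
    unfolding canonical_tree_def V 0 1 image_insert image_empty by simp
  moreover have "{a, b, c, d, e, f, g} = {a, d, g, b, e, f, c}"
    for a b c d e f g :: "nat set"
    by auto
  ultimately show ?thesis
    by (simp only: insert_commute[of 1 0 "{}"] insert_commute[of 2 1 "{}"]
        insert_commute[of 3 7 "{}"] insert_commute[of 4 0 "{}"] insert_commute[of 5 1 "{}"]
        insert_commute[of 6 7 "{}"] insert_commute[of 7 0 "{}"])
qed

lemma cobasis_wagner:
  "cobasis (graphic_matroid wagner) (canonical_tree wagner 1 0 7) =
     {{2,3}, {3,4}, {4,5}, {5,6}, {2,6}}"
  unfolding cobasis_def graphic_matroid_def canonical_tree_wagner edges_wagner
  by (simp add: insert_Diff_if doubleton_eq_iff) 

end

theory Submission
  imports Defs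
begin

text \<open>Every assertion concerns one graph with twelve edges, so it can be settled by finite checks; the
  mathematics below reduces each assertion to a check that term rewriting can carry out.

  Edge sets are lists of twelve truth values. The graph has 29 cycles, and a set of edges is a forest
  if and only if it contains none of them (\<open>forest_wagner_iff\<close>); that the list of cycles is complete is
  seen by following all paths.

  No generalized cycle system consists of circuits. A nonempty subfamily \<open>S\<close> violates the condition
  if and only if some edge of \<open>\<Union>i\<in>S. C i\<close> can be added to the set of elements lying in exactly one
  \<open>C i\<close> without closing a cycle. Pairs of distinct circuits never violate it, but most triples do: of
  the 3654 triples of circuits 782 survive, of the quadruples whose subfamilies all survive there are
  117, and there is no quintuple (\<open>search_fails\<close>). As the corank is 5, a system would be such a
  quintuple.

  The \<open>h\<close>-vector. At \<open>y = 1\<close> only independent sets contribute to the Tutte polynomial, so \<open>h\<close> is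
  determined by the number of independent sets of each size (\<open>h_vector_from_f_vector\<close>). These numbers,
  for \<open>M(V\<^sub>8)\<close> and for the minors \<open>K\<^sub>\<sigma>\<close>, come from one recursion over the edges that deletes or
  contracts the current edge in the list of cycles (\<open>count_indep\<close>).

  Strata. A baseline is positive on its stratum and zero elsewhere. Hence \<open>\<sigma>\<close> can be fired from \<open>a\<close> if
  and only if \<open>b\<^sub>\<sigma> \<le> a\<close>, and a stratum may be replaced by its baseline, a list of five numbers. There are
  21 live and 10 dead strata, and the \<open>h\<close>-vectors of the ten matroids \<open>K\<^sub>\<sigma>\<close> are \<open>(1)\<close>, \<open>(1, 1)\<close> and
  \<open>(1, 2)\<close>. A multicomplex with such a degree sequence consists of \<open>0\<close> and of \<open>r = h\<^sub>1\<close> unit vectors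
  (\<open>star_if_degree_sequence\<close>). So a fibre at \<open>\<sigma>\<close> is a choice of an \<open>r\<close>-element set \<open>I\<^sub>\<sigma>\<close> of directions, and
  condition (ii) confines it to the directions \<open>j\<close> for which \<open>b\<^sub>\<sigma> + e\<^sub>j\<close> lies above no live baseline
  (\<open>fibre_choice_of_fibre_system\<close>). Conversely all these choices, made independently at the ten dead
  strata, satisfy condition (ii); making one of them gives a fibre system (\<open>fibre_system_first\<close>).

  The set \<open>\<P>\<^sup>*(F)\<close>. For each vector \<open>a\<close> the condition defining \<open>\<P>\<^sup>*(F)\<close> becomes a list of demands
  \<open>j \<in> I\<^sub>\<sigma>\<close>, or it cannot be met at all (\<open>coparks_vec_iff\<close>). Only finitely many vectors are not excluded,
  and each of them makes at most one demand. The number of vectors of degree \<open>k\<close> demanding \<open>j \<in> I\<^sub>\<sigma>\<close> is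
  the same for all admissible \<open>j\<close>. Hence the degree sequence depends on the sizes of the \<open>I\<^sub>\<sigma>\<close> alone, and
  these are the same for all fibre systems (\<open>card_coparking_lists\<close>). For purity it suffices that each
  vector of degree less than 7 can be increased by a unit vector inside \<open>\<P>\<^sup>*(F)\<close> (\<open>nonmaximal\<close>): one can
  do this without a new demand, or else there is a dead \<open>\<sigma>\<close> such that every admissible direction
  \<open>j\<close> at \<open>\<sigma>\<close> leads to a vector demanding just \<open>j \<in> I\<^sub>\<sigma>\<close>, and \<open>I\<^sub>\<sigma>\<close> is not empty.\<close>

section \<open>The cycles of the Wagner graph\<close>

definition wagner_edges :: "(nat \<times> nat) list" where
  "wagner_edges = [(0,1), (1,2), (2,3), (3,4), (4,5), (5,6), (6,7), (7,0), (0,4), (1,5), (2,6), (3,7)]"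

definition wagner_cycles :: "nat list list" where
  "wagner_cycles = [
    [0,1,5,4], [1,2,6,5], [2,3,7,6], [0,4,3,7],
    [0,1,2,3,4], [0,1,2,3,7], [0,1,2,6,7], [0,1,5,6,7],
    [1,2,3,4,5], [2,3,4,5,6], [3,4,5,6,7], [0,4,5,6,7],
    [0,1,2,6,5,4], [0,1,5,4,3,7], [1,2,3,7,6,5], [0,4,3,2,6,7],
    [0,1,2,6,7,3,4], [0,1,5,6,2,3,4], [0,1,5,6,2,3,7], [0,1,5,6,7,3,4],
    [0,4,5,1,2,3,7], [1,2,6,7,3,4,5], [0,4,5,1,2,6,7], [0,4,5,6,2,3,7],
    [0,1,2,3,4,5,6,7], [0,1,2,3,7,6,5,4], [0,1,2,6,5,4,3,7], [0,1,5,4,3,2,6,7],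
    [0,4,3,2,1,5,6,7]]"

abbreviation MW :: "nat set matroid" where
  "MW \<equiv> graphic_matroid wagner"

definition edge_list :: "nat set list" where
  "edge_list = map (\<lambda>(a, b). {a, b}) wagner_edges"

definition bits :: "nat set set \<Rightarrow> bool list" where
  "bits X = map (\<lambda>e. e \<in> X) edge_list"

definition subbits :: "bool list \<Rightarrow> bool list \<Rightarrow> bool" where
  "subbits xs ys \<longleftrightarrow> list_all2 (\<longrightarrow>) xs ys"

definition polygon_bits :: "nat list \<Rightarrow> bool list" where
  "polygon_bits vs = (let st = zip vs (rotate1 vs) in
     map (\<lambda>(a, b). (a, b) \<in> set st \<or> (b, a) \<in> set st) wagner_edges)"

definition status :: "nat set set \<Rightarrow> nat set set \<Rightarrow> (bool \<times> bool) list" where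
  "status U A = map (\<lambda>e. (e \<in> U, e \<in> A)) edge_list"

definition has_cycle :: "bool list \<Rightarrow> bool" where
  "has_cycle xs \<longleftrightarrow> list_ex (\<lambda>c. subbits c xs) (map polygon_bits wagner_cycles)"

lemma set_edge_list: "set edge_list = edges wagner"
  unfolding edges_wagner edge_list_def wagner_edges_def by simp

lemma length_edge_list [simp]: "length edge_list = 12"
  unfolding edge_list_def wagner_edges_def by simp

lemma distinct_edge_list: "distinct edge_list"
  unfolding edge_list_def wagner_edges_def by (simp add: doubleton_eq_iff)

lemma finite_edges_wagner: "finite (edges wagner)"
  unfolding edges_wagner by simp

lemma length_bits [simp]: "length (bits X) = 12"
  unfolding bits_def by simp

lemma subbits_bits: "X \<subseteq> edges wagner \<Longrightarrow> subbits (bits X) (bits Y) \<longleftrightarrow> X \<subseteq> Y"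
  unfolding subbits_def bits_def list_all2_map1 list_all2_map2 list_all2_same set_edge_list
  by blast

lemma bits_inject: "X \<subseteq> edges wagner \<Longrightarrow> Y \<subseteq> edges wagner \<Longrightarrow> bits X = bits Y \<longleftrightarrow> X = Y"
  by (metis subbits_bits subset_antisym order_refl)

lemma polygon_eq: "polygon vs = (\<lambda>(a, b). {a, b}) ` set (zip vs (rotate1 vs))"
proof -
  have "set (zip vs (rotate1 vs)) = {(vs ! i, vs ! (Suc i mod length vs)) | i. i < length vs}"
    by (auto simp: set_zip nth_rotate1)
  then show ?thesis
    unfolding polygon_def by auto
qed

lemma bits_polygon: "bits (polygon vs) = polygon_bits vs"
  unfolding bits_def edge_list_def polygon_bits_def polygon_eq Let_def
  by (auto simp: doubleton_eq_iff image_iff)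

text \<open>Checking whether a set contains a cycle is the innermost operation of the searches below.
  Unfolding the list of cycles once and for all, for a list of twelve variables, and turning the
  disjunction into nested conditionals, of which only the decisive ones are evaluated, makes it cheap.\<close>

schematic_goal has_cycle_expand: "has_cycle [a,b,c,d,e,f,g,h,i,j,k,l] = ?t"
  unfolding has_cycle_def wagner_cycles_def polygon_bits_def wagner_edges_def Let_def subbits_def
  by simp

lemma disj_if: "(P \<or> Q) = (if P then True else Q)"
  by simp

lemmas has_cycle_code [code] = has_cycle_expand [unfolded disj_if]

definition neighbours :: "nat \<Rightarrow> nat list" where
  "neighbours v = [b. (a, b) \<leftarrow> wagner_edges, a = v] @ [a. (a, b) \<leftarrow> wagner_edges, b = v]"

lemma set_neighbours: "w \<in> set (neighbours v) \<longleftrightarrow> {v, w} \<in> edges wagner"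
  unfolding neighbours_def set_edge_list[symmetric] edge_list_def by (auto simp: image_iff doubleton_eq_iff)

text \<open>Paths are stored with their last vertex first.\<close>

fun paths :: "nat \<Rightarrow> nat list list" where
  "paths 0 = []"
| "paths (Suc 0) = map (\<lambda>v. [v]) [0..<8]"
| "paths (Suc (Suc n)) = [w # p. p \<leftarrow> paths (Suc n), w \<leftarrow> neighbours (hd p), w \<notin> set p]"

lemma paths_complete:
  assumes "distinct vs" and "\<And>i. Suc i < length vs \<Longrightarrow> {vs ! i, vs ! Suc i} \<in> edges wagner"
    and "vs \<noteq> []" and "hd vs < 8"
  shows "vs \<in> set (paths (length vs))"
  using assms
proof (induction vs)
  case (Cons w p)
  show ?case
  proof (cases p)
    case Nil
    with Cons.prems show ?thesis by auto
  next
    case (Cons v q)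
    have e: "{w, v} \<in> edges wagner"
      using Cons.prems(2)[of 0] \<open>p = v # q\<close> by simp
    then have "v < 8"
      unfolding edges_wagner insert_iff doubleton_eq_iff by auto
    moreover have "{p ! i, p ! Suc i} \<in> edges wagner" if "Suc i < length p" for i
      using Cons.prems(2)[of "Suc i"] that by simp
    ultimately have "p \<in> set (paths (length p))"
      using Cons.IH Cons.prems(1) \<open>p = v # q\<close> by simp
    moreover have "w \<in> set (neighbours v)"
      using e by (simp add: set_neighbours insert_commute)
    ultimately show ?thesis
      using Cons.prems(1) \<open>p = v # q\<close> by force
  qed
qed simp

definition closed_path_ok :: "nat list \<Rightarrow> bool" where
  "closed_path_ok p = (if hd p \<in> set (neighbours (last p)) then has_cycle (polygon_bits p) else True)"

lemma closed_paths: "list_all (\<lambda>n. list_all closed_path_ok (paths n)) [3..<9]"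
  by code_simp

text \<open>A cycle, read from any of its vertices, is a path with at most eight vertices whose ends are
  adjacent, and all such paths have been enumerated in \<open>closed_paths\<close>. It is enough that the polygon
  of each contains a listed cycle; equality then follows for circuits by minimality.\<close>

lemma polygon_has_cycle:
  assumes "distinct vs" "3 \<le> length vs" "polygon vs \<subseteq> edges wagner"
  shows "has_cycle (bits (polygon vs))"
proof -
  have e: "{vs ! i, vs ! (Suc i mod length vs)} \<in> edges wagner" if "i < length vs" for i
    using assms(3) that unfolding polygon_def by auto
  have lt: "v < 8" if v: "v \<in> set vs" for v
  proof -
    obtain i where "i < length vs" "v = vs ! i"
      using v by (metis in_set_conv_nth)
    then show ?thesis
      using e[of i] unfolding edges_wagner insert_iff doubleton_eq_iff by auto
  qed
  have "vs \<noteq> []" using assms(2) by auto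
  have "set vs \<subseteq> {..<8}" using lt by auto
  then have len: "length vs < 9"
    using card_mono[of "{..<8::nat}" "set vs"] assms(1) by (simp add: distinct_card)
  have "vs \<in> set (paths (length vs))"
    by (rule paths_complete) (use assms(1) e lt \<open>vs \<noteq> []\<close> in \<open>auto simp: mod_Suc split: if_splits\<close>, 
      metis Suc_lessD e less_not_refl mod_less)
  then have "closed_path_ok vs"
    using closed_paths len assms(2) unfolding list_all_iff
    by (metis atLeastLessThan_iff set_upt)
  moreover have "hd vs \<in> set (neighbours (last vs))"
    using e[of "length vs - 1"] \<open>vs \<noteq> []\<close> by (simp add: set_neighbours last_conv_nth hd_conv_nth)
  ultimately show ?thesis
    by (simp add: closed_path_ok_def bits_polygon)
qed

lemma wagner_cycles_are_cycles:
  assumes "vs \<in> set wagner_cycles"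
  shows "distinct vs" "3 \<le> length vs" "polygon vs \<subseteq> edges wagner"
proof -
  have *: "list_all (\<lambda>vs. distinct vs \<and> 3 \<le> length vs \<and>
      list_all (\<lambda>(a, b). b \<in> set (neighbours a)) (zip vs (rotate1 vs))) wagner_cycles"
    by code_simp
  then show "distinct vs" "3 \<le> length vs" "polygon vs \<subseteq> edges wagner"
    using assms unfolding list_all_iff polygon_eq set_neighbours by auto
qed

lemma has_cycle_bits_iff: "has_cycle (bits Y) \<longleftrightarrow> (\<exists>vs\<in>set wagner_cycles. polygon vs \<subseteq> Y)"
  using subbits_bits wagner_cycles_are_cycles(3)
  unfolding has_cycle_def list_ex_iff by (auto simp flip: bits_polygon)

theorem forest_wagner_iff:
  assumes "X \<subseteq> edges wagner"
  shows "forest wagner X \<longleftrightarrow> \<not> has_cycle (bits X)"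
proof -
  have "(\<exists>vs. distinct vs \<and> 3 \<le> length vs \<and> polygon vs \<subseteq> X) \<longleftrightarrow> has_cycle (bits X)"
  proof
    assume "\<exists>vs. distinct vs \<and> 3 \<le> length vs \<and> polygon vs \<subseteq> X"
    then obtain vs where vs: "distinct vs" "3 \<le> length vs" "polygon vs \<subseteq> X" by blast
    then have "has_cycle (bits (polygon vs))"
      using assms by (intro polygon_has_cycle) auto
    then show "has_cycle (bits X)"
      using vs(3) unfolding has_cycle_bits_iff by blast
  next
    assume "has_cycle (bits X)"
    then show "\<exists>vs. distinct vs \<and> 3 \<le> length vs \<and> polygon vs \<subseteq> X"
      unfolding has_cycle_bits_iff using wagner_cycles_are_cycles by blast
  qed
  then show ?thesis
    using assms unfolding forest_def by blast
qed

lemma indep_MW: "indep MW = forest wagner" and ground_MW: "ground MW = edges wagner"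
  unfolding graphic_matroid_def by simp_all

lemma dependent_MW_iff: "dependent MW D \<longleftrightarrow> D \<subseteq> edges wagner \<and> has_cycle (bits D)"
  unfolding dependent_def indep_MW ground_MW using forest_wagner_iff by blast

theorem circuit_MW_iff: "circuit MW C \<longleftrightarrow> C \<in> polygon ` set wagner_cycles"
proof -
  \<comment> \<open>Listed cycles are minimal dependent sets because none contains another one.\<close>
  have antichain: "polygon vs = polygon ws"
    if "vs \<in> set wagner_cycles" "ws \<in> set wagner_cycles" "polygon vs \<subseteq> polygon ws" for vs ws
  proof -
    have "(let css = map polygon_bits wagner_cycles in
        list_all (\<lambda>c. list_all (\<lambda>d. c = d \<or> \<not> subbits c d) css) css)"
      by code_simp
    then have "polygon_bits vs = polygon_bits ws \<or> \<not> subbits (polygon_bits vs) (polygon_bits ws)"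
      using that(1,2) unfolding Let_def list_all_iff by auto
    then show ?thesis
      using that subbits_bits bits_inject wagner_cycles_are_cycles(3)
      by (auto simp flip: bits_polygon)
  qed
  show ?thesis
  proof
    assume C: "circuit MW C"
    then obtain vs where vs: "vs \<in> set wagner_cycles" "polygon vs \<subseteq> C"
      unfolding circuit_def dependent_MW_iff has_cycle_bits_iff by blast
    then have "dependent MW (polygon vs)"
      unfolding dependent_MW_iff has_cycle_bits_iff using wagner_cycles_are_cycles(3) by blast
    then show "C \<in> polygon ` set wagner_cycles"
      using C vs unfolding circuit_def by blast
  next
    assume "C \<in> polygon ` set wagner_cycles"
    then show "circuit MW C"
      unfolding circuit_def dependent_MW_iff has_cycle_bits_iff
      using wagner_cycles_are_cycles(3) antichain by blast
  qed
qed

section \<open>Searching for a generalized cycle system\<close>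

lemma forest_empty: "forest G {}"
  unfolding forest_def polygon_def by force

definition good_subfamily :: "('i \<Rightarrow> nat set set) \<Rightarrow> 'i set \<Rightarrow> bool" where
  "good_subfamily C T \<longleftrightarrow> dependent MW (exactly_once C T) \<or>
     basis (restriction MW (\<Union>i\<in>T. C i)) (exactly_once C T)"

text \<open>For each edge: does it lie in exactly one member of the subfamily, and does it lie in any? These
  two data suffice to update the state when a further circuit joins the subfamily.\<close>

definition state :: "('i \<Rightarrow> nat set set) \<Rightarrow> 'i set \<Rightarrow> (bool \<times> bool) list" where
  "state C T = status (exactly_once C T) (\<Union>i\<in>T. C i)"

definition add_cycle :: "(bool \<times> bool) list \<Rightarrow> bool list \<Rightarrow> (bool \<times> bool) list" where
  "add_cycle st xs = map2 (\<lambda>(p, u) x. (if x then \<not> u else p, if x then True else u)) st xs"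

text \<open>Is there an edge in some member, but not in exactly one, that can be added to the set of edges
  lying in exactly one member without creating a cycle? The argument \<open>pre\<close> collects the entries
  already passed, so that the enlarged set can be reassembled.\<close>

fun augmentable :: "bool list \<Rightarrow> (bool \<times> bool) list \<Rightarrow> bool" where
  "augmentable pre [] = False"
| "augmentable pre ((p, u) # st) =
     (if (if p then True else if u then has_cycle (pre @ True # map fst st) else True)
      then augmentable (pre @ [p]) st else True)"

fun admissible :: "(bool \<times> bool) list list \<Rightarrow> bool list \<Rightarrow> bool" where
  "admissible [] d = True"
| "admissible (st # sts) d = (if augmentable [] (add_cycle st d) then False else admissible sts d)"

fun admissibles :: "(bool \<times> bool) list list \<Rightarrow> bool list list \<Rightarrow> bool list list" where
  "admissibles sts [] = []"
| "admissibles sts (d # ds) =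
     (if admissible sts d then d # admissibles sts ds else admissibles sts ds)"

fun add_to_all :: "bool list \<Rightarrow> (bool \<times> bool) list list \<Rightarrow> (bool \<times> bool) list list" where
  "add_to_all c [] = []"
| "add_to_all c (st # sts) = add_cycle st c # add_to_all c sts"

text \<open>Are there \<open>n\<close> further circuits in \<open>cs\<close> compatible with those already chosen? The list \<open>sts\<close> contains
  the states of the nonempty subfamilies of the chosen circuits. When \<open>c\<close> is chosen, only candidates
  compatible with the subfamilies containing \<open>c\<close> and one more chosen circuit at least are kept. The
  pair formed by \<open>c\<close> and a candidate is not examined: pairs never violate the condition, and
  the search only has to overlook no solution.\<close>

fun search :: "(bool \<times> bool) list list \<Rightarrow> nat \<Rightarrow> bool list list \<Rightarrow> bool" where
  "search sts 0 cs = True"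
| "search sts (Suc n) [] = False"
| "search sts (Suc n) (c # cs) =
     (if search sts (Suc n) cs then True
      else (let new = add_to_all c sts
            in search (map (\<lambda>x. (x, x)) c # new @ sts) n (admissibles new cs)))"

lemma multiplicity_insert:
  assumes "finite T" "i \<notin> T"
  shows "multiplicity_in C (insert i T) e =
    (if e \<in> C i then Suc (multiplicity_in C T e) else multiplicity_in C T e)"
proof -
  have "{j \<in> insert i T. e \<in> C j} =
      (if e \<in> C i then insert i {j \<in> T. e \<in> C j} else {j \<in> T. e \<in> C j})"
    by auto
  then show ?thesis
    using assms unfolding multiplicity_in_def by simp
qed

lemma multiplicity_0_iff: "finite T \<Longrightarrow> multiplicity_in C T e = 0 \<longleftrightarrow> e \<notin> (\<Union>i\<in>T. C i)"
  unfolding multiplicity_in_def by auto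

lemma multiplicity_ge_1_iff: "finite T \<Longrightarrow> 1 \<le> multiplicity_in C T e \<longleftrightarrow> e \<in> (\<Union>i\<in>T. C i)"
  using multiplicity_0_iff[of T C e] by (metis less_one not_less)

lemma state_insert:
  assumes "finite T" "i \<notin> T"
  shows "state C (insert i T) = add_cycle (state C T) (bits (C i))"
  unfolding state_def status_def add_cycle_def bits_def map2_map_map
  by (rule map_cong)
     (auto simp: exactly_once_def multiplicity_insert[OF assms] multiplicity_0_iff[OF assms(1)]
       split: if_splits)

lemma state_singleton: "state C {i} = map (\<lambda>x. (x, x)) (bits (C i))"
proof -
  have "{j. j = i \<and> e \<in> C j} = (if e \<in> C i then {i} else {})" for e
    by auto
  then show ?thesis
    unfolding state_def status_def bits_def exactly_once_def multiplicity_in_def by (auto split: if_splits)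
qed

lemma map_fst_state: "map fst (state C T) = bits (exactly_once C T)"
  unfolding state_def status_def bits_def by auto

lemma length_state [simp]: "length (state C T) = 12"
  unfolding state_def status_def by simp

lemma augmentableD:
  "augmentable pre st \<Longrightarrow>
     \<exists>i<length st. snd (st ! i) \<and> \<not> fst (st ! i) \<and> \<not> has_cycle (pre @ (map fst st)[i := True])"
proof (induction pre st rule: augmentable.induct)
  case (2 pre p u st)
  show ?case
  proof (cases "u \<and> \<not> p \<and> \<not> has_cycle (pre @ True # map fst st)")
    case True
    then show ?thesis by (intro exI[of _ 0]) auto
  next
    case False
    then have c: "if p then True else if u then has_cycle (pre @ True # map fst st) else True"
      by auto
    then have "augmentable (pre @ [p]) st"
      using "2.prems" by simp
    then obtain i where "i < length st" "snd (st ! i)" "\<not> fst (st ! i)"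
      "\<not> has_cycle (pre @ p # (map fst st)[i := True])"
      using "2.IH"[OF c] by auto
    then show ?thesis by (intro exI[of _ "Suc i"]) auto
  qed
qed simp

lemma exactly_once_subset: "exactly_once C T \<subseteq> (\<Union>i\<in>T. C i)"
proof
  fix e
  assume "e \<in> exactly_once C T"
  then have "card {i \<in> T. e \<in> C i} \<noteq> 0"
    unfolding exactly_once_def multiplicity_in_def by simp
  then show "e \<in> (\<Union>i\<in>T. C i)"
    by (metis (mono_tags, lifting) UN_I card.empty empty_Collect_eq)
qed

lemma bits_insert: "i < 12 \<Longrightarrow> bits (insert (edge_list ! i) X) = (bits X)[i := True]"
  by (rule nth_equalityI)
     (auto simp: bits_def nth_list_update nth_eq_iff_index_eq distinct_edge_list)

text \<open>If an edge of the union could be added, then the elements lying in exactly one member would form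
  a forest, so they would not be dependent, and a forest that is not maximal in the union.\<close>

lemma good_subfamily_not_augmentable:
  assumes "good_subfamily C T" "\<And>i. i \<in> T \<Longrightarrow> C i \<subseteq> edges wagner"
  shows "\<not> augmentable [] (state C T)"
proof
  let ?O = "exactly_once C T" and ?A = "\<Union>i\<in>T. C i"
  assume "augmentable [] (state C T)"
  then obtain i where i: "i < 12" "snd (state C T ! i)" "\<not> fst (state C T ! i)"
    "\<not> has_cycle ((bits ?O)[i := True])"
    using augmentableD[of "[]" "state C T"] by (auto simp: map_fst_state)
  define e where "e = edge_list ! i"
  have A: "?A \<subseteq> edges wagner" using assms(2) by auto
  have "state C T ! i = (e \<in> ?O, e \<in> ?A)"
    unfolding state_def status_def e_def using i(1) by (subst nth_map) simp_all
  then have e: "e \<in> ?A" "e \<notin> ?O"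
    using i(2,3) by (simp_all only: fst_conv snd_conv not_False_eq_True)
  have sub: "insert e ?O \<subseteq> ?A"
    using e(1) exactly_once_subset[of C T] by simp
  have f: "forest wagner (insert e ?O)"
    using i(1,4) sub A by (subst forest_wagner_iff) (auto simp: bits_insert e_def)
  then have "forest wagner ?O"
    unfolding forest_def by blast
  then have "\<not> dependent MW ?O"
    unfolding dependent_def indep_MW by simp
  moreover have "\<not> basis (restriction MW ?A) ?O"
  proof
    assume "basis (restriction MW ?A) ?O"
    then have "\<forall>J. J \<subseteq> ?A \<and> forest wagner J \<and> ?O \<subseteq> J \<longrightarrow> J = ?O"
      unfolding basis_def restriction_def indep_MW by simp
    then have "insert e ?O = ?O"
      using f sub by (metis subset_insertI)
    then show False
      using e(2) by blast
  qed
  ultimately show False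
    using assms(1) unfolding good_subfamily_def by blast
qed

lemma set_add_to_all: "set (add_to_all c sts) = (\<lambda>st. add_cycle st c) ` set sts"
  by (induction sts) auto

lemma admissible_iff:
  "admissible sts d \<longleftrightarrow> (\<forall>st\<in>set sts. \<not> augmentable [] (add_cycle st d))"
  by (induction sts) auto

lemma set_admissibles: "set (admissibles sts ds) = {d \<in> set ds. admissible sts d}"
  by (induction ds) auto

text \<open>The induction generalizes over the set \<open>S\<close> of circuits chosen so far and the set \<open>D\<close> of circuits of the
  solution still to be found. If the first candidate belongs to \<open>D\<close> it moves to \<open>S\<close>, and no other member
  of \<open>D\<close> is filtered out; otherwise the candidate can be skipped.\<close>

theorem search_complete:
  assumes "finite S" "finite D" "card D = n" "S \<inter> D = {}" "inj_on C D"
    and "\<And>i. i \<in> S \<union> D \<Longrightarrow> C i \<subseteq> edges wagner"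
    and "\<And>i. i \<in> D \<Longrightarrow> bits (C i) \<in> set cs"
    and "\<And>T. T \<subseteq> S \<union> D \<Longrightarrow> T \<noteq> {} \<Longrightarrow> good_subfamily C T"
    and "\<And>st. st \<in> set sts \<Longrightarrow> \<exists>T\<subseteq>S. T \<noteq> {} \<and> st = state C T"
  shows "search sts n cs"
  using assms
proof (induction sts n cs arbitrary: S D rule: search.induct)
  case (2 sts n)
  then have "D = {}" by auto
  then show ?case using "2.prems" by simp
next
  case (3 sts n c cs)
  show ?case
  proof (cases "\<exists>i\<in>D. bits (C i) = c")
    case False
    then have "search sts (Suc n) cs"
      using "3.IH"(1)[of S D] "3.prems" by auto
    then show ?thesis by simp
  next
    case True
    then obtain i where i: "i \<in> D" "bits (C i) = c" by blast
    define new where "new = add_to_all c sts"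
    have new: "\<exists>T\<subseteq>insert i S. T \<noteq> {} \<and> st = state C T \<and> i \<in> T" if st: "st \<in> set new" for st
    proof -
      obtain T where T: "T \<subseteq> S" "T \<noteq> {}" "st = add_cycle (state C T) c"
        using st "3.prems"(9) unfolding new_def set_add_to_all by blast
      have "finite T" "i \<notin> T"
        using T(1) i(1) "3.prems"(1,4) finite_subset by blast+
      then have "st = state C (insert i T)"
        unfolding T(3) i(2)[symmetric] by (rule state_insert[symmetric])
      then show ?thesis using T(1) by (intro exI[of _ "insert i T"] conjI) auto
    qed
    have "search (map (\<lambda>x. (x, x)) c # new @ sts) n (admissibles new cs)" if "\<not> search sts (Suc n) cs"
    proof (rule "3.IH"(2)[OF that new_def, of "insert i S" "D - {i}"])
      show "finite (insert i S)" "finite (D - {i})" "card (D - {i}) = n"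
        "insert i S \<inter> (D - {i}) = {}" "inj_on C (D - {i})"
        using "3.prems"(1-5) i(1) by (auto simp: inj_on_diff)
      have SD: "insert i S \<union> (D - {i}) = S \<union> D" using i(1) by auto
      show "C j \<subseteq> edges wagner" if "j \<in> insert i S \<union> (D - {i})" for j
        using that "3.prems"(6) unfolding SD by blast
      show "good_subfamily C T" if "T \<subseteq> insert i S \<union> (D - {i})" "T \<noteq> {}" for T
        using that "3.prems"(8) unfolding SD by blast
      show "\<exists>T\<subseteq>insert i S. T \<noteq> {} \<and> st = state C T"
        if st: "st \<in> set (map (\<lambda>x. (x, x)) c # new @ sts)" for st
      proof -
        consider "st = state C {i}" | "st \<in> set new" | "st \<in> set sts"
          using st i(2) state_singleton[of C i] by auto
        then show ?thesis
        proof cases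
          case 1
          then show ?thesis by blast
        next
          case 2
          then show ?thesis using new by blast
        next
          case 3
          then show ?thesis using "3.prems"(9)[OF 3] by blast
        qed
      qed
      show "bits (C j) \<in> set (admissibles new cs)" if j: "j \<in> D - {i}" for j
      proof -
        have "C j \<noteq> C i"
          using j i(1) "3.prems"(5) by (auto dest: inj_onD)
        then have "bits (C j) \<noteq> c"
          using j i "3.prems"(6) by (auto simp: bits_inject)
        then have "bits (C j) \<in> set cs"
          using j "3.prems"(7)[of j] by auto
        moreover have "\<not> augmentable [] (add_cycle st (bits (C j)))" if st: "st \<in> set new" for st
        proof -
          obtain T where T: "T \<subseteq> insert i S" "T \<noteq> {}" "st = state C T"
            using new[OF st] by blast
          have "finite T" "j \<notin> T"
            using T(1) j i(1) "3.prems"(1,4) finite_subset[of T "insert i S"] by blast+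
          then have "add_cycle st (bits (C j)) = state C (insert j T)"
            unfolding T(3) by (rule state_insert[symmetric])
          moreover have "insert j T \<subseteq> S \<union> D" using T(1) j i(1) by auto
          then have "\<not> augmentable [] (state C (insert j T))"
            using "3.prems"(6,8) by (intro good_subfamily_not_augmentable) auto
          ultimately show ?thesis by simp
        qed
        ultimately show ?thesis
          unfolding set_admissibles admissible_iff by blast
      qed
    qed
    then show ?thesis
      unfolding search.simps Let_def new_def by simp
  qed
qed simp

lemma forest_single_edge:
  assumes "e \<in> edges wagner"
  shows "forest wagner {e}"
proof -
  have False if vs: "vs \<in> set wagner_cycles" "polygon vs \<subseteq> {e}" for vs
  proof -
    obtain a b c ws where abc: "vs = a # b # c # ws"
      using wagner_cycles_are_cycles(2)[OF vs(1)] unfolding numeral_3_eq_3 Suc_le_length_iff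
      by blast
    then have "{a, b} \<in> polygon vs" "{b, c} \<in> polygon vs"
      unfolding polygon_eq by auto
    then have "{a, b} = {b, c}"
      using vs(2) by blast
    moreover have "a \<noteq> b" "a \<noteq> c"
      using wagner_cycles_are_cycles(1)[OF vs(1)] abc by auto
    ultimately show False
      by (auto simp: doubleton_eq_iff)
  qed
  then show ?thesis
    using assms forest_wagner_iff has_cycle_bits_iff by blast
qed

lemma search_fails: "\<not> search [] 5 (map polygon_bits wagner_cycles)"
  by code_simp

text \<open>Two equal circuits would have no element lying in exactly one of them, and the empty set is not a
  maximal forest in a circuit. So the circuits are distinct, and the search would have found them.\<close>

theorem no_good_five_circuits:
  assumes "finite D" "card D = 5" "\<And>i. i \<in> D \<Longrightarrow> circuit MW (C i)"
    and good: "\<And>T. T \<subseteq> D \<Longrightarrow> T \<noteq> {} \<Longrightarrow> good_subfamily C T"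
  shows False
proof -
  have cyc: "C i \<in> polygon ` set wagner_cycles" if "i \<in> D" for i
    using assms(3)[OF that] unfolding circuit_MW_iff .
  have sub: "C i \<subseteq> edges wagner" if "i \<in> D" for i
    using assms(3)[OF that] unfolding circuit_def dependent_def ground_MW by blast
  have "inj_on C D"
  proof (rule inj_onI, rule ccontr)
    fix i j
    assume ij: "i \<in> D" "j \<in> D" "C i = C j" "i \<noteq> j"
    have "{k \<in> {i, j}. e \<in> C k} = (if e \<in> C i then {i, j} else {})" for e
      using ij(3) by auto
    then have "exactly_once C {i, j} = {}"
      using ij(4) unfolding exactly_once_def multiplicity_in_def by simp
    then have b: "basis (restriction MW (C i)) {}"
      using good[of "{i, j}"] ij forest_empty[of wagner]
      unfolding good_subfamily_def dependent_def indep_MW by simp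
    obtain vs where vs: "vs \<in> set wagner_cycles" "C i = polygon vs"
      using cyc[OF ij(1)] by blast
    have "polygon vs \<noteq> {}"
      using wagner_cycles_are_cycles(2)[OF vs(1)] unfolding polygon_def by force
    then obtain e where e: "e \<in> C i" using vs(2) by blast
    then have "forest wagner {e}"
      using forest_single_edge sub[OF ij(1)] by blast
    moreover have "\<forall>J. J \<subseteq> C i \<and> forest wagner J \<longrightarrow> J = {}"
      using b unfolding basis_def restriction_def indep_MW by simp
    ultimately show False
      using e by blast
  qed
  have "search [] 5 (map polygon_bits wagner_cycles)"
  proof (rule search_complete[where S = "{}" and D = D and C = C])
    show "bits (C i) \<in> set (map polygon_bits wagner_cycles)" if "i \<in> D" for i
      using cyc[OF that] by (auto simp: bits_polygon)
    show "C i \<subseteq> edges wagner" if "i \<in> {} \<union> D" for i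
      using sub that by blast
    show "good_subfamily C T" if "T \<subseteq> {} \<union> D" "T \<noteq> {}" for T
      using good that by blast
  qed (use assms(1,2) \<open>inj_on C D\<close> in auto)
  then show False
    using search_fails by blast
qed

section \<open>The h-vector from the numbers of independent sets\<close>

text \<open>A set \<open>X\<close> contributes the factor \<open>0 ^ (card X - rk X)\<close>. As the rank is the size of a largest independent
  subset, this factor is 1 for independent \<open>X\<close> and 0 otherwise.\<close>

lemma tutte_from_f_vector:
  fixes M :: "'e matroid" and fs :: "int list"
  assumes G: "finite (ground M)" "\<And>J. indep M J \<Longrightarrow> J \<subseteq> ground M" "indep M {}"
    and fs: "(\<Sum>J | indep M J. monom 1 (card J)) = Poly fs" "length fs = Suc d" "fs ! d \<noteq> 0"
  shows "rank_of M = d"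
    and "tutte M [:0, 1:] (1 :: int poly) = (\<Sum>j\<le>d. smult (fs ! j) ([:-1, 1:] ^ (d - j)))"
proof -
  let ?I = "{J. indep M J}"
  have fin: "finite ?I"
    using G by (intro finite_subset[of ?I "Pow (ground M)"]) auto
  have count: "int (card {J \<in> ?I. card J = j}) = nth_default 0 fs j" for j
  proof -
    have "nth_default 0 fs j = coeff (\<Sum>J\<in>?I. monom (1::int) (card J)) j"
      unfolding fs(1) by simp
    also have "\<dots> = (\<Sum>J\<in>?I. if card J = j then 1 else 0)"
      unfolding coeff_sum coeff_monom ..
    also have "\<dots> = int (card {J \<in> ?I. card J = j})"
      using fin by (simp add: sum.If_cases Int_def)
    finally show ?thesis ..
  qed
  have le: "card J \<le> d" if "indep M J" for J
  proof (rule ccontr)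
    assume "\<not> card J \<le> d"
    then have "int (card {J' \<in> ?I. card J' = card J}) = 0"
      unfolding count using fs(2) by (simp add: nth_default_def)
    then show False
      using that fin by auto
  qed
  have "int (card {J \<in> ?I. card J = d}) \<noteq> 0"
    unfolding count using fs(2,3) by (simp add: nth_default_def)
  then have "{J \<in> ?I. card J = d} \<noteq> {}"
    by (metis card.empty of_nat_0)
  then obtain J where J: "indep M J" "card J = d"
    by blast
  show r: "rank_of M = d"
    unfolding rk_def
  proof (rule Max_eqI)
    show "finite (card ` {J. J \<subseteq> ground M \<and> indep M J})"
      using fin by simp
    show "d \<in> card ` {J. J \<subseteq> ground M \<and> indep M J}"
      using J G(2) by blast
  qed (use le in auto)
  have rk_indep: "rk M X = card X" if X: "indep M X" for X
    unfolding rk_def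
  proof (rule Max_eqI)
    have fX: "finite X" using finite_subset[OF G(2)[OF X] G(1)] .
    then show "finite (card ` {J. J \<subseteq> X \<and> indep M J})" by simp
    show "n \<le> card X" if "n \<in> card ` {J. J \<subseteq> X \<and> indep M J}" for n
      using that fX by (auto intro: card_mono)
  qed (use X in auto)
  have rk_dep: "rk M X < card X" if X: "X \<subseteq> ground M" "\<not> indep M X" for X
  proof -
    have fX: "finite X" using finite_subset[OF X(1) G(1)] .
    have "{J. J \<subseteq> X \<and> indep M J} \<noteq> {}" using G(3) by blast
    moreover have "card J < card X" if "J \<subseteq> X" "indep M J" for J
      using that X(2) fX by (metis psubsetI psubset_card_mono)
    ultimately show ?thesis
      unfolding rk_def using fX by (subst Max_less_iff) auto
  qed
  let ?q = "[:-1, 1:] :: int poly"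
  have q: "[:0, 1:] - 1 = ?q"
    by (simp add: one_pCons)
  have "tutte M [:0, 1:] (1 :: int poly) =
      (\<Sum>X\<in>Pow (ground M). ?q ^ (d - rk M X) * 0 ^ (card X - rk M X))"
    unfolding tutte_def q r by simp
  \<comment> \<open>A dependent set is larger than its rank, so its term contains a positive power of zero.\<close>
  also have "\<dots> = (\<Sum>X\<in>?I. ?q ^ (d - rk M X) * 0 ^ (card X - rk M X))"
  proof (rule sum.mono_neutral_right)
    show "\<forall>X\<in>Pow (ground M) - ?I. ?q ^ (d - rk M X) * 0 ^ (card X - rk M X) = 0"
    proof
      fix X
      assume "X \<in> Pow (ground M) - ?I"
      then have "0 < card X - rk M X" using rk_dep[of X] by simp
      then show "?q ^ (d - rk M X) * 0 ^ (card X - rk M X) = 0" by (simp add: zero_power)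
    qed
  qed (use G in auto)
  also have "\<dots> = (\<Sum>X\<in>?I. ?q ^ (d - card X))"
    by (intro sum.cong) (auto simp: rk_indep)
  also have "\<dots> = (\<Sum>j\<le>d. \<Sum>X | X \<in> ?I \<and> card X = j. ?q ^ (d - card X))"
    using fin le by (intro sum.group[symmetric]) auto
  also have "\<dots> = (\<Sum>j\<le>d. smult (fs ! j) (?q ^ (d - j)))"
  proof (rule sum.cong)
    fix j
    assume j: "j \<in> {..d}"
    have "int (card {X \<in> ?I. card X = j}) = fs ! j"
      using count[of j] j fs(2) by (simp add: nth_default_def)
    then have "smult (fs ! j) (?q ^ (d - j)) = of_nat (card {X \<in> ?I. card X = j}) * ?q ^ (d - j)"
      by (metis of_nat_mult_conv_smult)
    also have "\<dots> = (\<Sum>X | X \<in> ?I \<and> card X = j. ?q ^ (d - card X))"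
      by simp
    finally show "(\<Sum>X | X \<in> ?I \<and> card X = j. ?q ^ (d - card X)) = smult (fs ! j) (?q ^ (d - j))" ..
  qed simp
  finally show "tutte M [:0, 1:] (1 :: int poly) = (\<Sum>j\<le>d. smult (fs ! j) (?q ^ (d - j)))" .
qed

lemma h_vector_from_f_vector:
  fixes M :: "'e matroid"
  assumes "finite (ground M)" "\<And>J. indep M J \<Longrightarrow> J \<subseteq> ground M" "indep M {}"
    and "(\<Sum>J | indep M J. monom 1 (card J)) = Poly fs" "length fs = Suc d" "fs ! d \<noteq> 0"
    and hs: "(\<Sum>j\<le>d. smult (fs ! j) ([:-1, 1:] ^ (d - j))) = Poly (rev hs)" "length hs = Suc d"
  shows "h_vector M k = nth_default 0 hs k"
proof -
  have "rank_of M = d" and "tutte M [:0, 1:] (1 :: int poly) = Poly (rev hs)"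
    using tutte_from_f_vector[of M fs d] assms by simp_all
  then show ?thesis
    unfolding h_vector_def using hs(2) by (auto simp: nth_default_def rev_nth)
qed

fun ladd :: "int list \<Rightarrow> int list \<Rightarrow> int list" where
  "ladd (x # xs) (y # ys) = (x + y) # ladd xs ys"
| "ladd [] ys = ys"
| "ladd xs [] = xs"

lemma Poly_ladd: "Poly (ladd xs ys) = Poly xs + Poly ys"
  by (induction xs ys rule: ladd.induct) auto

text \<open>The list of the numbers of sets \<open>J\<close> of each size such that \<open>J\<close> avoids \<open>U\<close>, lies in \<open>A\<close>, and contains with
  \<open>U\<close> none of the cycles in \<open>cs\<close>; an entry \<open>(p, a)\<close> says whether the edge is in \<open>U\<close> and whether it is in \<open>A\<close>.
  Taking the current edge removes it from all cycles, leaving it out destroys the cycles through it.\<close>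

fun count_indep :: "(bool \<times> bool) list \<Rightarrow> bool list list \<Rightarrow> int list" where
  "count_indep [] cs = (if cs = [] then [1] else [])"
| "count_indep ((p, a) # st) cs =
     (if p then count_indep st (map tl cs)
      else if a then ladd (count_indep st (map tl (filter (Not \<circ> hd) cs)))
                          (0 # count_indep st (map tl cs))
      else count_indep st (map tl (filter (Not \<circ> hd) cs)))"

definition indep_bits :: "(bool \<times> bool) list \<Rightarrow> bool list list \<Rightarrow> bool list set" where
  "indep_bits st cs = {xs. list_all2 (\<lambda>x (p, a). x \<longrightarrow> a \<and> \<not> p) xs st \<and>
     (\<forall>c\<in>set cs. \<not> subbits c (map2 (\<lambda>x (p, a). x \<or> p) xs st))}"

lemma finite_indep_bits: "finite (indep_bits st cs)"
proof (rule finite_subset)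
  show "indep_bits st cs \<subseteq> {xs. set xs \<subseteq> UNIV \<and> length xs = length st}"
    unfolding indep_bits_def by (auto dest: list_all2_lengthD)
qed (rule finite_lists_length_eq, simp)

lemma indep_bits_Cons:
  assumes "\<forall>c\<in>set cs. length c = Suc (length st)"
  shows "indep_bits ((p, a) # st) cs =
    (if p then Cons False ` indep_bits st (map tl cs)
     else Cons False ` indep_bits st (map tl (filter (Not \<circ> hd) cs)) \<union>
       (if a then Cons True ` indep_bits st (map tl cs) else {}))"
proof -
  have c: "subbits c (x # xs) \<longleftrightarrow> (hd c \<longrightarrow> x) \<and> subbits (tl c) xs" if "c \<in> set cs" for c x xs
    using assms that by (cases c) (auto simp: subbits_def)
  show ?thesis
    by (auto simp: indep_bits_def list_all2_Cons2 c image_iff)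
qed

lemma sum_monom_Cons:
  assumes "finite S"
  shows "(\<Sum>xs\<in>Cons False ` S. monom (1::int) (count_list xs True)) =
      (\<Sum>xs\<in>S. monom 1 (count_list xs True))"
    and "(\<Sum>xs\<in>Cons True ` S. monom (1::int) (count_list xs True)) =
      pCons 0 (\<Sum>xs\<in>S. monom 1 (count_list xs True))"
proof -
  show "(\<Sum>xs\<in>Cons False ` S. monom (1::int) (count_list xs True)) =
      (\<Sum>xs\<in>S. monom 1 (count_list xs True))"
    by (subst sum.reindex) (auto simp: inj_on_def)
  have "(\<Sum>xs\<in>Cons True ` S. monom (1::int) (count_list xs True)) =
      (\<Sum>xs\<in>S. pCons 0 (monom 1 (count_list xs True)))"
    by (subst sum.reindex) (auto simp: inj_on_def monom_Suc)
  also have "\<dots> = (\<Sum>xs\<in>S. [:0, 1:] * monom 1 (count_list xs True))"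
    by simp
  finally show "(\<Sum>xs\<in>Cons True ` S. monom (1::int) (count_list xs True)) =
      pCons 0 (\<Sum>xs\<in>S. monom 1 (count_list xs True))"
    unfolding sum_distrib_left[symmetric] by simp
qed

lemma count_indep_correct:
  assumes "\<forall>c\<in>set cs. length c = length st"
  shows "Poly (count_indep st cs) = (\<Sum>xs\<in>indep_bits st cs. monom 1 (count_list xs True))"
  using assms
proof (induction st cs rule: count_indep.induct)
  case (1 cs)
  have "indep_bits [] cs = (if cs = [] then {[]} else {})"
    using 1 by (cases cs) (auto simp: indep_bits_def subbits_def)
  then show ?case
    by (simp add: monom_0)
next
  case (2 p a st cs)
  have len: "\<forall>c\<in>set cs. length c = Suc (length st)"
    "\<forall>c\<in>set (map tl cs). length c = length st"
    "\<forall>c\<in>set (map tl (filter (Not \<circ> hd) cs)). length c = length st"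
    using 2(5) by auto
  have split: "(\<Sum>xs\<in>Cons False ` S \<union> Cons True ` T. monom (1::int) (count_list xs True)) =
      (\<Sum>xs\<in>S. monom 1 (count_list xs True)) + pCons 0 (\<Sum>xs\<in>T. monom 1 (count_list xs True))"
    if "finite S" "finite T" for S T
    using that by (subst sum.union_disjoint) (auto simp: sum_monom_Cons)
  show ?case
    using 2(1-4) len(2,3)
    unfolding indep_bits_Cons[OF len(1)]
    by (simp add: Poly_ladd sum_monom_Cons split finite_indep_bits)
qed

lemma bits_surj:
  assumes "length xs = 12"
  obtains X where "X \<subseteq> edges wagner" "bits X = xs"
proof
  define X where "X = {edge_list ! i | i. i < 12 \<and> xs ! i}"
  show "X \<subseteq> edges wagner"
    unfolding X_def set_edge_list[symmetric] by auto
  show "bits X = xs"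
  proof (rule nth_equalityI)
    fix i
    assume "i < length (bits X)"
    then show "bits X ! i = xs ! i"
      by (auto simp: bits_def X_def nth_eq_iff_index_eq distinct_edge_list)
  qed (simp add: assms)
qed

lemma card_eq_count_bits:
  assumes "X \<subseteq> edges wagner"
  shows "card X = count_list (bits X) True"
proof -
  have "X = set (filter (\<lambda>e. e \<in> X) edge_list)"
    using assms set_edge_list by auto
  then have "card X = length (filter (\<lambda>e. e \<in> X) edge_list)"
    using distinct_edge_list by (metis distinct_card distinct_filter)
  also have "\<dots> = count_list (bits X) True"
    unfolding bits_def by (simp add: count_list_eq_length_filter filter_map comp_def)
  finally show ?thesis .
qed

text \<open>The sets \<open>J\<close> in the sum are the independent sets of \<open>(M|A)/U\<close> when \<open>U\<close> is a forest; the matroid of the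
  whole graph is the case \<open>U = {}\<close>.\<close>

theorem f_polynomial_minor:
  assumes "U \<subseteq> A" "A \<subseteq> edges wagner"
  shows "(\<Sum>J | J \<subseteq> A - U \<and> forest wagner (J \<union> U). monom 1 (card J)) =
    Poly (count_indep (status U A) (map polygon_bits wagner_cycles))"
proof -
  let ?I = "{J. J \<subseteq> A - U \<and> forest wagner (J \<union> U)}"
  let ?cs = "map polygon_bits wagner_cycles"
  have join: "map2 (\<lambda>x (p, a). x \<or> p) (bits J) (status U A) = bits (J \<union> U)" for J
    unfolding bits_def status_def map2_map_map by auto
  have mem: "bits J \<in> indep_bits (status U A) ?cs \<longleftrightarrow> J \<in> ?I" if J: "J \<subseteq> edges wagner" for J
  proof -
    have "list_all2 (\<lambda>x (p, a). x \<longrightarrow> a \<and> \<not> p) (bits J) (status U A) \<longleftrightarrow> J \<subseteq> A - U"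
      using J unfolding bits_def status_def list_all2_map1 list_all2_map2 list_all2_same set_edge_list
      by auto
    moreover have "(\<forall>c\<in>set ?cs. \<not> subbits c (bits (J \<union> U))) \<longleftrightarrow> forest wagner (J \<union> U)"
      using forest_wagner_iff[of "J \<union> U"] J assms unfolding has_cycle_def list_ex_iff by blast
    ultimately show ?thesis
      by (simp add: indep_bits_def join)
  qed
  have sub: "J \<subseteq> edges wagner" if "J \<in> ?I" for J
    using that assms(2) by auto
  have inj: "inj_on bits ?I"
    using bits_inject sub by (intro inj_onI) metis
  have "bits ` ?I = indep_bits (status U A) ?cs"
  proof
    show "bits ` ?I \<subseteq> indep_bits (status U A) ?cs"
    proof (rule image_subsetI)
      fix J
      assume "J \<in> ?I"
      then show "bits J \<in> indep_bits (status U A) ?cs"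
        using mem[OF sub] by simp
    qed
    show "indep_bits (status U A) ?cs \<subseteq> bits ` ?I"
    proof
      fix xs
      assume xs: "xs \<in> indep_bits (status U A) ?cs"
      then have "length xs = 12"
        unfolding indep_bits_def status_def by (auto dest: list_all2_lengthD)
      then obtain X where "X \<subseteq> edges wagner" "bits X = xs"
        using bits_surj by blast
      then show "xs \<in> bits ` ?I"
        using xs mem[of X] by (intro image_eqI[of _ _ X]) simp_all
    qed
  qed
  then have "(\<Sum>xs\<in>indep_bits (status U A) ?cs. monom (1::int) (count_list xs True)) =
      (\<Sum>J\<in>?I. monom 1 (count_list (bits J) True))"
    using sum.reindex[OF inj] by (metis (no_types, lifting) comp_apply sum.cong)
  also have "\<dots> = (\<Sum>J\<in>?I. monom 1 (card J))"
    by (intro sum.cong refl) (simp only: card_eq_count_bits[OF sub])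
  finally have "(\<Sum>J\<in>?I. monom (1::int) (card J)) =
      (\<Sum>xs\<in>indep_bits (status U A) ?cs. monom 1 (count_list xs True))" ..
  also have "\<dots> = Poly (count_indep (status U A) ?cs)"
    by (rule count_indep_correct[symmetric]) (auto simp: status_def simp flip: bits_polygon)
  finally show ?thesis .
qed

section \<open>The matroid of the Wagner graph and its minors\<close>

lemma h_vector_MW: "h_vector MW k = nth_default 0 [1, 5, 15, 35, 66, 98, 106, 66] k"
  and rank_MW: "rank_of MW = 7"
proof -
  let ?fs = "[1, 12, 66, 220, 491, 752, 752, 392] :: int list"
  have "{J. J \<subseteq> edges wagner - {} \<and> forest wagner (J \<union> {})} = {J. indep MW J}"
    unfolding indep_MW forest_def by auto
  then have "(\<Sum>J | indep MW J. monom (1::int) (card J)) =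
      Poly (count_indep (status {} (edges wagner)) (map polygon_bits wagner_cycles))"
    using f_polynomial_minor[of "{}" "edges wagner"] by simp
  also have "status {} (edges wagner) = replicate 12 (False, True)"
    unfolding status_def by (rule replicate_eqI) (auto simp: set_edge_list)
  also have "count_indep (replicate 12 (False, True)) (map polygon_bits wagner_cycles) =
      ?fs @ [0, 0, 0, 0]"
    by code_simp
  also have "Poly (?fs @ [0, 0, 0, 0]) = Poly ?fs"
    by simp
  finally have fs: "(\<Sum>J | indep MW J. monom (1::int) (card J)) = Poly ?fs" .
  have fin: "finite (ground MW)" "\<And>J. indep MW J \<Longrightarrow> J \<subseteq> ground MW" "indep MW {}"
    unfolding indep_MW ground_MW using finite_edges_wagner forest_empty
    by (auto simp: forest_def)
  show "rank_of MW = 7"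
    using tutte_from_f_vector(1)[OF fin fs, of 7] by simp
  show "h_vector MW k = nth_default 0 [1, 5, 15, 35, 66, 98, 106, 66] k"
  proof (rule h_vector_from_f_vector[OF fin fs])
    show "(\<Sum>j\<le>7. smult (?fs ! j) ([:-1, 1:] ^ (7 - j))) = Poly (rev [1, 5, 15, 35, 66, 98, 106, 66])"
      by (simp add: eval_nat_numeral)
  qed simp_all
qed

text \<open>A forest \<open>U\<close> is the only basis of the restriction to \<open>U\<close>.\<close>

lemma K_indep_iff:
  assumes "U \<subseteq> A" "A \<subseteq> edges wagner" "forest wagner U"
  shows "indep (contraction (restriction MW A) U) J \<longleftrightarrow> J \<subseteq> A - U \<and> forest wagner (J \<union> U)"
    and "ground (contraction (restriction MW A) U) = A - U"
proof -
  show g: "ground (contraction (restriction MW A) U) = A - U"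
    using assms(2) unfolding contraction_def restriction_def ground_MW by auto
  have b: "basis (restriction (restriction MW A) U) K \<longleftrightarrow> K = U" for K
    using assms(1,3) unfolding basis_def restriction_def indep_MW by auto
  show "indep (contraction (restriction MW A) U) J \<longleftrightarrow> J \<subseteq> A - U \<and> forest wagner (J \<union> U)"
    unfolding contraction_def b using assms(1,2)
    by (auto simp: restriction_def indep_MW ground_MW)
qed

lemma h_vector_K:
  assumes "U \<subseteq> A" "A \<subseteq> edges wagner" "forest wagner U"
    and f: "strip_while ((=) 0) (count_indep (status U A) (map polygon_bits wagner_cycles)) = fs"
    and "length fs = Suc d" "fs ! d \<noteq> 0"
    and "(\<Sum>j\<le>d. smult (fs ! j) ([:-1, 1:] ^ (d - j))) = Poly (rev hs)" "length hs = Suc d"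
  shows "h_vector (contraction (restriction MW A) U) k = nth_default 0 hs k"
proof (rule h_vector_from_f_vector[OF _ _ _ _ assms(5-8)])
  let ?K = "contraction (restriction MW A) U"
  note K = K_indep_iff[OF assms(1-3)]
  show "finite (ground ?K)"
    unfolding K(2) using finite_subset[OF assms(2) finite_edges_wagner] by simp
  show "J \<subseteq> ground ?K" if "indep ?K J" for J
    using that unfolding K by blast
  show "indep ?K {}"
    unfolding K using assms(3) by simp
  show "(\<Sum>J | indep ?K J. monom (1::int) (card J)) = Poly fs"
    unfolding K f_polynomial_minor[OF assms(1,2)] f[symmetric]
    by (simp add: poly_eq_iff nth_default_strip_while_dflt)
qed

section \<open>Multicomplexes of degree at most one\<close>

definition indicator_vec :: "'i \<Rightarrow> 'i \<Rightarrow> nat" where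
  "indicator_vec i j = (if j = i then 1 else 0)"

definition star :: "'i set \<Rightarrow> ('i \<Rightarrow> nat) set" where
  "star J = insert (\<lambda>_. 0) (indicator_vec ` J)"

lemma below_indicator_vec: "a \<le> indicator_vec i \<Longrightarrow> a = (\<lambda>_. 0) \<or> a = indicator_vec i"
proof -
  assume a: "a \<le> indicator_vec i"
  have "a j = 0" if "j \<noteq> i" for j
    using le_funD[OF a, of j] that by (simp add: indicator_vec_def)
  moreover have "a i \<le> 1"
    using le_funD[OF a, of i] by (simp add: indicator_vec_def)
  ultimately have "a = (if a i = 0 then (\<lambda>_. 0) else indicator_vec i)"
  proof (intro ext)
    fix j
    show "a j = (if a i = 0 then (\<lambda>_. 0) else indicator_vec i) j"
      using \<open>a i \<le> 1\<close> \<open>\<And>j. j \<noteq> i \<Longrightarrow> a j = 0\<close> by (cases "j = i") (auto simp: indicator_vec_def)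
  qed
  then show ?thesis
    by (auto split: if_splits)
qed

lemma sum_indicator_vec: "finite \<sigma> \<Longrightarrow> i \<in> \<sigma> \<Longrightarrow> sum (indicator_vec i) \<sigma> = 1"
  unfolding indicator_vec_def by simp

lemma inj_indicator_vec: "inj indicator_vec"
  by (rule injI) (metis indicator_vec_def zero_neq_one)

text \<open>If there is a unit vector, then \<open>0\<close> is not maximal, and the maximal elements all have degree 1.\<close>

lemma pure_multicomplex_star:
  assumes "finite \<sigma>" "J \<subseteq> \<sigma>"
  shows "pure_multicomplex \<sigma> (star J)"
proof -
  have m: "multicomplex \<sigma> (star J)"
    unfolding multicomplex_def
  proof (intro conjI ballI allI impI)
    show "finite (star J)"
      unfolding star_def using assms finite_subset by blast
    show "star J \<subseteq> exponents \<sigma>"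
      unfolding star_def exponents_def indicator_vec_def using assms(2) by auto
    fix a b
    assume ab: "a \<in> star J" "b \<le> a"
    show "b \<in> star J"
    proof (cases "a = (\<lambda>_. 0)")
      case True
      then have "b = (\<lambda>_. 0)"
        using ab(2) by (auto simp: le_fun_def)
      then show ?thesis by (simp add: star_def)
    next
      case False
      then obtain j where "j \<in> J" "a = indicator_vec j"
        using ab(1) unfolding star_def by blast
      then show ?thesis
        using below_indicator_vec[of b j] ab(2) unfolding star_def by blast
    qed
  qed
  have deg: "sum a \<sigma> = (if J = {} then 0 else 1)" if a: "maximal_in (star J) a" for a
  proof (cases "J = {}")
    case True
    then show ?thesis using a unfolding maximal_in_def star_def by simp
  next
    case False
    then obtain j where j: "j \<in> J" by blast
    have "(\<lambda>_. 0) \<le> indicator_vec j" "indicator_vec j \<noteq> (\<lambda>_. 0)"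
      by (auto simp: le_fun_def indicator_vec_def fun_eq_iff)
    then have "a \<noteq> (\<lambda>_. 0)"
      using a j unfolding maximal_in_def star_def by blast
    then obtain i where "i \<in> J" "a = indicator_vec i"
      using a unfolding maximal_in_def star_def by blast
    then show ?thesis
      using assms False sum_indicator_vec[of \<sigma> i] by auto
  qed
  show ?thesis
    unfolding pure_multicomplex_def using m deg by auto
qed

lemma degree_sequence_star:
  assumes "finite \<sigma>" "J \<subseteq> \<sigma>"
  shows "has_degree_sequence \<sigma> (star J) (nth_default 0 [1, int (card J)])"
  unfolding has_degree_sequence_def
proof
  fix k :: nat
  have s: "sum (indicator_vec j) \<sigma> = 1" if "j \<in> J" for j
    by (rule sum_indicator_vec[OF assms(1) subsetD[OF assms(2) that]])
  consider "k = 0" | "k = 1" | "k \<ge> 2" by linarith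
  then show "int (card {a \<in> star J. sum a \<sigma> = k}) = nth_default 0 [1, int (card J)] k"
  proof cases
    case 1
    then have "{a \<in> star J. sum a \<sigma> = k} = {\<lambda>_. 0}"
      unfolding star_def using s by auto
    then show ?thesis using 1 by simp
  next
    case 2
    then have "{a \<in> star J. sum a \<sigma> = k} = indicator_vec ` J"
      unfolding star_def using s by auto
    moreover have "card (indicator_vec ` J) = card J"
      by (rule card_image) (use inj_indicator_vec in \<open>auto intro: inj_on_subset\<close>)
    ultimately show ?thesis using 2 by (simp add: nth_default_def)
  next
    case 3
    then have *: "{a \<in> star J. sum a \<sigma> = k} = {}"
      unfolding star_def using s by auto
    show ?thesis
      unfolding * using 3 by (simp add: nth_default_def)
  qed
qed

text \<open>Degree sequence \<open>(1, r)\<close> excludes elements of degree 2 or more, so that only \<open>0\<close> and unit vectors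
  remain, and \<open>r\<close> counts the latter. The case \<open>r = 0\<close> covers the degree sequence \<open>(1)\<close>.\<close>

lemma star_if_degree_sequence:
  assumes "finite \<sigma>" "multicomplex \<sigma> P" "has_degree_sequence \<sigma> P (nth_default 0 [1, int r])"
  shows "P = star {i \<in> \<sigma>. indicator_vec i \<in> P}" and "card {i \<in> \<sigma>. indicator_vec i \<in> P} = r"
proof -
  let ?J = "{i \<in> \<sigma>. indicator_vec i \<in> P}"
  have fin: "finite P" and exp: "P \<subseteq> exponents \<sigma>" and down: "\<And>a b. a \<in> P \<Longrightarrow> b \<le> a \<Longrightarrow> b \<in> P"
    using assms(2) unfolding multicomplex_def by auto
  have deg: "int (card {a \<in> P. sum a \<sigma> = k}) = nth_default 0 [1, int r] k" for k
    using assms(3) unfolding has_degree_sequence_def by blast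
  have "{a \<in> P. sum a \<sigma> = 0} \<noteq> {}"
  proof
    assume *: "{a \<in> P. sum a \<sigma> = 0} = {}"
    show False using deg[of 0] unfolding * by simp
  qed
  then have zero: "(\<lambda>_. 0) \<in> P"
    using down by (auto simp: le_fun_def)
  have "P \<subseteq> star ?J"
  proof
    fix a
    assume a: "a \<in> P"
    have "sum a \<sigma> < 2"
    proof (rule ccontr)
      assume "\<not> sum a \<sigma> < 2"
      then have "int (card {a' \<in> P. sum a' \<sigma> = sum a \<sigma>}) = 0"
        unfolding deg by (simp add: nth_default_def)
      then show False using a fin by auto
    qed
    show "a \<in> star ?J"
    proof (cases "a = (\<lambda>_. 0)")
      case True
      then show ?thesis by (simp add: star_def)
    next
      case False
      then obtain i where i: "a i \<noteq> 0" by auto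
      then have "i \<in> \<sigma>"
        using subsetD[OF exp a] unfolding exponents_def by auto
      have le: "indicator_vec i \<le> a"
        using i by (auto simp: le_fun_def indicator_vec_def)
      then have P: "indicator_vec i \<in> P"
        using down a by blast
      have "a j = indicator_vec i j" for j
      proof (cases "j \<in> \<sigma>")
        case True
        show ?thesis
        proof (rule ccontr)
          assume "a j \<noteq> indicator_vec i j"
          \<comment> \<open>A further unit in \<open>a\<close> would raise its degree above 1.\<close>
          then have "indicator_vec i j < a j"
            using le_funD[OF le, of j] by simp
          then have "sum (indicator_vec i) \<sigma> < sum a \<sigma>"
            using assms(1) le_funD[OF le] True by (intro sum_strict_mono_ex1) auto
          then show False
            using sum_indicator_vec[OF assms(1) \<open>i \<in> \<sigma>\<close>] \<open>sum a \<sigma> < 2\<close> by simp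
        qed
      next
        case False
        then show ?thesis
          using subsetD[OF exp a] \<open>i \<in> \<sigma>\<close> unfolding exponents_def indicator_vec_def by auto
      qed
      then have "a = indicator_vec i" by (rule ext)
      then show ?thesis
        using P \<open>i \<in> \<sigma>\<close> unfolding star_def by blast
    qed
  qed
  moreover have "star ?J \<subseteq> P"
    unfolding star_def using zero by auto
  ultimately show P: "P = star ?J" by blast
  have "int (card {a \<in> P. sum a \<sigma> = 1}) = int (card ?J)"
    using degree_sequence_star[OF assms(1), of ?J] P
    unfolding has_degree_sequence_def by (simp add: nth_default_def)
  then show "card ?J = r"
    unfolding deg by (simp add: nth_default_def)
qed

section \<open>Strata and their baselines\<close>

abbreviation BW :: "nat set set" where
  "BW \<equiv> canonical_tree wagner 1 0 7"

definition chords :: "nat set list" where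
  "chords = [{2,3}, {3,4}, {4,5}, {5,6}, {2,6}]"

definition fund_cycles :: "nat list list" where
  "fund_cycles = [[0,1,2,3,7], [0,4,3,7], [0,1,5,4], [0,1,5,6,7], [0,1,2,6,7]]"

lemma length_fund_cycles [simp]: "length fund_cycles = 5"
  unfolding fund_cycles_def by simp

lemma set_chords: "set chords = cobasis MW BW"
  unfolding cobasis_wagner chords_def by simp

lemma distinct_chords: "distinct chords"
  unfolding chords_def by (simp add: doubleton_eq_iff)

lemma length_chords [simp]: "length chords = 5"
  unfolding chords_def by simp

lemma chords_nth: "i < 5 \<Longrightarrow> chords ! i = edge_list ! ([2, 3, 4, 5, 10] ! i)"
  unfolding chords_def edge_list_def wagner_edges_def
  by (auto simp: less_Suc_eq numeral_eq_Suc)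

lemma bits_BW:
  "bits BW = [True, True, False, False, False, False, True, True, True, True, False, True]"
  unfolding canonical_tree_wagner bits_def edge_list_def wagner_edges_def
  by (simp add: doubleton_eq_iff)

text \<open>Among the 29 cycles just one lies in the tree together with the given chord.\<close>

lemma fundamental_circuit_chord:
  assumes "i < 5"
  shows "fundamental_circuit MW BW (chords ! i) = polygon (fund_cycles ! i)"
  unfolding fundamental_circuit_def
proof (rule the_equality)
  define T where "T = (bits BW)[[2, 3, 4, 5, 10] ! i := True]"
  have T: "bits (insert (chords ! i) BW) = T"
    using assms by (auto simp: T_def chords_nth less_Suc_eq numeral_eq_Suc intro!: bits_insert[simplified numeral_eq_Suc])
  have "list_all (\<lambda>i. let t = [True, True, False, False, False, False, True, True, True, True, False, True]
          [[2, 3, 4, 5, 10] ! i := True]; d = polygon_bits (fund_cycles ! i) in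
        subbits d t \<and> fund_cycles ! i \<in> set wagner_cycles \<and>
        list_all (\<lambda>vs. let c = polygon_bits vs in subbits c t \<longrightarrow> c = d) wagner_cycles) [0, 1, 2, 3, 4]"
    by code_simp
  moreover have "i \<in> set [0, 1, 2, 3, 4]"
    using assms by auto
  ultimately have *: "subbits (polygon_bits (fund_cycles ! i)) T" "fund_cycles ! i \<in> set wagner_cycles"
    "\<And>vs. vs \<in> set wagner_cycles \<Longrightarrow> subbits (polygon_bits vs) T \<Longrightarrow>
      polygon_bits vs = polygon_bits (fund_cycles ! i)"
    unfolding list_all_iff Let_def bits_BW T_def by blast+
  have sub: "polygon vs \<subseteq> insert (chords ! i) BW \<longleftrightarrow> subbits (polygon_bits vs) T"
    if "vs \<in> set wagner_cycles" for vs
    unfolding T[symmetric] bits_polygon[symmetric]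
    using subbits_bits[OF wagner_cycles_are_cycles(3)[OF that]] by simp
  show "circuit MW (polygon (fund_cycles ! i)) \<and> polygon (fund_cycles ! i) \<subseteq> insert (chords ! i) BW"
    using * sub unfolding circuit_MW_iff by blast
  fix C
  assume C: "circuit MW C \<and> C \<subseteq> insert (chords ! i) BW"
  then obtain vs where vs: "vs \<in> set wagner_cycles" "C = polygon vs"
    unfolding circuit_MW_iff by blast
  then have "polygon_bits vs = polygon_bits (fund_cycles ! i)"
    using C sub *(3) by blast
  then show "C = polygon (fund_cycles ! i)"
    using vs *(2) bits_inject[of "polygon vs" "polygon (fund_cycles ! i)"] wagner_cycles_are_cycles(3)
    unfolding bits_polygon by blast
qed

lemma fundamental_circuit_subset:
  assumes "r \<in> set chords"
  shows "fundamental_circuit MW BW r \<subseteq> edges wagner"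
proof -
  obtain i where i: "i < 5" "r = chords ! i"
    using assms by (auto simp: in_set_conv_nth)
  have "list_all (\<lambda>vs. vs \<in> set wagner_cycles) fund_cycles"
    by code_simp
  then have "fund_cycles ! i \<in> set wagner_cycles"
    using i(1) by (simp add: list_all_length)
  then show ?thesis
    unfolding i(2) fundamental_circuit_chord[OF i(1)] by (rule wagner_cycles_are_cycles(3))
qed

text \<open>Strata are handled as lists of five truth values selecting chords.\<close>

fun selected :: "'a list \<Rightarrow> bool list \<Rightarrow> 'a set" where
  "selected (r # rs) (s # ss) = (if s then insert r (selected rs ss) else selected rs ss)"
| "selected _ _ = {}"

fun selected_state :: "bool list list \<Rightarrow> bool list \<Rightarrow> (bool \<times> bool) list" where
  "selected_state (c # cs) (s # ss) =
     (let st = selected_state cs ss in if s then add_cycle st c else st)"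
| "selected_state _ _ = replicate 12 (False, False)"

lemma selected_subset: "selected rs ss \<subseteq> set rs"
  by (induction rs ss rule: selected.induct) auto

lemma finite_selected: "finite (selected rs ss)"
  using finite_subset[OF selected_subset finite_set] .

lemma selected_indicator: "selected rs (map (\<lambda>r. r \<in> \<sigma>) rs) = \<sigma> \<inter> set rs"
  by (induction rs) auto

lemma nth_mem_selected:
  "distinct rs \<Longrightarrow> length ss = length rs \<Longrightarrow> i < length rs \<Longrightarrow> rs ! i \<in> selected rs ss \<longleftrightarrow> ss ! i"
proof (induction rs ss arbitrary: i rule: selected.induct)
  case (1 r rs s ss)
  show ?case
  proof (cases i)
    case 0
    then show ?thesis using 1(3) selected_subset[of rs ss] by auto
  next
    case (Suc j)
    then show ?thesis using 1 by (auto simp: in_set_conv_nth)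
  qed
qed auto

lemma state_empty: "state C {} = replicate 12 (False, False)"
  unfolding state_def status_def exactly_once_def multiplicity_in_def by (rule replicate_eqI) auto

text \<open>The state built by adding the selected circuits one after the other is the state of the
  subfamily, because the chords are distinct.\<close>

lemma state_selected:
  "distinct rs \<Longrightarrow> length ss = length rs \<Longrightarrow>
   state C (selected rs ss) = selected_state (map (\<lambda>r. bits (C r)) rs) ss"
proof (induction rs ss rule: selected.induct)
  case (1 r rs s ss)
  then have "r \<notin> selected rs ss"
    using selected_subset[of rs ss] by auto
  then show ?case
    using 1 state_insert[OF finite_selected, of r rs ss C] by (simp add: Let_def)
qed (simp_all add: state_empty)

definition fund_bits :: "bool list list" where
  "fund_bits = map polygon_bits fund_cycles"

definition baseline_row :: "bool list \<Rightarrow> nat list" where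
  "baseline_row ss = (let u = map fst (selected_state fund_bits ss) in
     map2 (\<lambda>s c. if s then count_list (map2 (\<and>) c u) True else 0) ss fund_bits)"

definition live_row :: "bool list \<Rightarrow> bool" where
  "live_row ss = has_cycle (map fst (selected_state fund_bits ss))"

lemma fund_bits_eq: "fund_bits = map (\<lambda>r. bits (fundamental_circuit MW BW r)) chords"
proof (rule nth_equalityI)
  show "length fund_bits = length (map (\<lambda>r. bits (fundamental_circuit MW BW r)) chords)"
    unfolding fund_bits_def by simp
  fix i
  assume "i < length fund_bits"
  then show "fund_bits ! i = map (\<lambda>r. bits (fundamental_circuit MW BW r)) chords ! i"
    using fundamental_circuit_chord[of i] unfolding fund_bits_def
    by (simp only: length_map length_fund_cycles nth_map length_chords bits_polygon)
qed

context
  fixes ss :: "bool list"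
  assumes ss: "length ss = 5"
begin

lemma state_stratum:
  "state (fundamental_circuit MW BW) (selected chords ss) = selected_state fund_bits ss"
  unfolding fund_bits_eq using state_selected[OF distinct_chords] ss by simp

lemma bits_U: "bits (U_set MW BW (selected chords ss)) = map fst (selected_state fund_bits ss)"
  unfolding U_set_def state_stratum[symmetric] map_fst_state ..

lemma A_set_eq: "A_set MW BW (selected chords ss) = (\<Union>i\<in>selected chords ss. fundamental_circuit MW BW i)"
  unfolding A_set_def multiplicity_ge_1_iff[OF finite_selected] by (rule Collect_mem_eq)

lemma status_UA:
  "status (U_set MW BW (selected chords ss)) (A_set MW BW (selected chords ss)) =
     selected_state fund_bits ss"
  unfolding A_set_eq U_set_def state_stratum[symmetric] state_def ..

lemma UA_subset:
  "U_set MW BW (selected chords ss) \<subseteq> A_set MW BW (selected chords ss)"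
  "A_set MW BW (selected chords ss) \<subseteq> edges wagner"
  unfolding A_set_eq U_set_def
  by (rule exactly_once_subset, rule UN_least, rule fundamental_circuit_subset)
     (rule subsetD[OF selected_subset])

lemma dead_iff: "dead MW BW (selected chords ss) \<longleftrightarrow> \<not> live_row ss"
  unfolding dead_def indep_MW live_row_def bits_U[symmetric]
  using UA_subset by (intro forest_wagner_iff) simp

lemma baseline_eq:
  assumes "i < 5"
  shows "baseline MW BW (selected chords ss) (chords ! i) = baseline_row ss ! i"
proof -
  let ?U = "U_set MW BW (selected chords ss)" and ?C = "fundamental_circuit MW BW (chords ! i)"
  have "card (?C \<inter> ?U) = count_list (bits (?C \<inter> ?U)) True"
    using UA_subset by (intro card_eq_count_bits) auto
  also have "bits (?C \<inter> ?U) = map2 (\<and>) (bits ?C) (bits ?U)"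
    unfolding bits_def map2_map_map by auto
  also have "bits ?C = fund_bits ! i"
    unfolding fund_bits_eq using assms by simp
  finally have "card (?C \<inter> ?U) = count_list (map2 (\<and>) (fund_bits ! i) (bits ?U)) True" .
  moreover have "length fund_bits = 5"
    unfolding fund_bits_eq by simp
  ultimately show ?thesis
    using assms ss nth_mem_selected[OF distinct_chords, of ss i]
    unfolding baseline_def baseline_row_def bits_U Let_def by simp
qed

end

definition vec :: "nat list \<Rightarrow> nat set \<Rightarrow> nat" where
  "vec xs e = (case map_of (zip chords xs) e of None \<Rightarrow> 0 | Some n \<Rightarrow> n)"

lemma vec_nth: "length xs = 5 \<Longrightarrow> i < 5 \<Longrightarrow> vec xs (chords ! i) = xs ! i"
  unfolding vec_def using distinct_chords by (simp add: map_of_zip_nth)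

lemma vec_outside: "e \<notin> set chords \<Longrightarrow> vec xs e = 0"
  unfolding vec_def by (auto split: option.split dest!: map_of_SomeD dest: set_zip_leftD)

lemma vec_unique:
  assumes "length xs = 5" "\<And>i. i < 5 \<Longrightarrow> a (chords ! i) = xs ! i" "\<And>e. e \<notin> set chords \<Longrightarrow> a e = 0"
  shows "a = vec xs"
proof
  fix e
  show "a e = vec xs e"
    using assms vec_nth[OF assms(1)] vec_outside by (cases "e \<in> set chords") (auto simp: in_set_conv_nth)
qed

lemma length_baseline_row: "length ss = 5 \<Longrightarrow> length (baseline_row ss) = 5"
  unfolding baseline_row_def Let_def fund_bits_eq by simp

lemma baseline_vec:
  assumes "length ss = 5"
  shows "baseline MW BW (selected chords ss) = vec (baseline_row ss)"
proof (rule vec_unique)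
  show "baseline MW BW (selected chords ss) e = 0" if "e \<notin> set chords" for e
    using that selected_subset[of chords ss] unfolding baseline_def by auto
qed (use assms baseline_eq length_baseline_row in auto)

definition live_rows :: "nat list list" where
  "live_rows = [
    [5,0,0,0,0], [0,4,0,0,0], [3,2,0,0,0], [0,0,4,0,0], [4,0,3,0,0], [0,3,3,0,0], [2,1,2,0,0],
    [0,0,0,5,0], [3,0,0,3,0], [0,3,0,4,0], [0,0,2,3,0], [0,2,1,2,0], [0,0,0,0,5], [2,0,0,0,2],
    [0,3,0,0,4], [0,0,3,0,4], [2,0,3,0,2], [0,2,2,0,3], [0,0,0,2,2], [0,3,0,2,2], [1,1,1,1,1]]"

text \<open>An entry \<open>(b, L, r)\<close> consists of the baseline \<open>b\<close> of a dead stratum, of the directions \<open>L\<close> that a fibre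
  there may use, and of the number \<open>r = h\<^sub>1\<close> of directions that it must use. If \<open>r = 0\<close> then \<open>L\<close> is set
  to the empty list.\<close>

definition dead_rows :: "(nat list \<times> nat list \<times> nat) list" where
  "dead_rows = [
    ([2,2,0,3,0], [], 0),      ([3,0,2,2,0], [], 0),      ([2,1,1,2,0], [0,3], 2),
    ([1,2,0,0,2], [1,4], 1),   ([1,1,2,0,2], [1,2,4], 2), ([2,0,0,2,1], [0,3], 1),
    ([1,2,0,2,1], [0,1,3], 2), ([0,0,2,1,2], [2,4], 1),   ([2,0,2,1,1], [0,2,3], 2),
    ([0,2,1,1,2], [1,2,4], 2)]"

text \<open>A baseline is positive exactly on its stratum (\<open>baseline_row_supp\<close>), so it determines the stratum.\<close>

definition supp :: "nat list \<Rightarrow> nat set set" where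
  "supp b = selected chords (map ((<) 0) b)"

definition nonempty_selections :: "bool list list" where
  "nonempty_selections = filter (\<lambda>ss. True \<in> set ss) (List.n_lists 5 [False, True])"

lemma live_rows_correct: "map baseline_row (filter live_row nonempty_selections) = live_rows"
  by code_simp

text \<open>In the three cases the numbers of independent sets of \<open>K\<^sub>\<sigma>\<close> are \<open>(1)\<close>, \<open>(1, 2)\<close> and \<open>(1, 3)\<close>. Trailing
  zeros, which count sizes larger than the rank, are removed.\<close>

lemma dead_rows_correct:
  "map (\<lambda>ss. (baseline_row ss,
       strip_while ((=) 0) (count_indep (selected_state fund_bits ss) (map polygon_bits wagner_cycles))))
     (filter (Not \<circ> live_row) nonempty_selections) =
   map (\<lambda>(b, L, r). (b, if r = 0 then [1] else [1, int r + 1])) dead_rows"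
  by code_simp

lemma baseline_row_supp: "list_all (\<lambda>ss. map ((<) 0) (baseline_row ss) = ss) nonempty_selections"
  by code_simp

lemma set_nonempty_selections: "ss \<in> set nonempty_selections \<longleftrightarrow> length ss = 5 \<and> True \<in> set ss"
  unfolding nonempty_selections_def by (auto simp: set_n_lists)

lemma supp_baseline_row:
  "ss \<in> set nonempty_selections \<Longrightarrow> supp (baseline_row ss) = selected chords ss"
  using baseline_row_supp unfolding list_all_iff supp_def by auto

lemma selected_eq_empty_iff: "length ss = length rs \<Longrightarrow> selected rs ss = {} \<longleftrightarrow> True \<notin> set ss"
  by (induction rs ss rule: selected.induct) auto

lemma stratum_iff: "stratum MW BW \<sigma> \<longleftrightarrow> \<sigma> \<in> selected chords ` set nonempty_selections"
proof
  assume "stratum MW BW \<sigma>"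
  then have \<sigma>: "\<sigma> \<subseteq> set chords" "\<sigma> \<noteq> {}"
    unfolding stratum_def set_chords by auto
  let ?ss = "map (\<lambda>r. r \<in> \<sigma>) chords"
  have eq: "selected chords ?ss = \<sigma>"
    unfolding selected_indicator using \<sigma>(1) by blast
  then have "?ss \<in> set nonempty_selections"
    using \<sigma>(2) selected_eq_empty_iff[of ?ss chords] unfolding set_nonempty_selections by simp
  then show "\<sigma> \<in> selected chords ` set nonempty_selections"
    using eq by (metis imageI)
next
  assume "\<sigma> \<in> selected chords ` set nonempty_selections"
  then obtain ss where "ss \<in> set nonempty_selections" and ss: "\<sigma> = selected chords ss"
    by (elim imageE)
  then have "length ss = 5" "True \<in> set ss"
    by (simp_all add: set_nonempty_selections)
  with ss show "stratum MW BW \<sigma>"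
    using selected_eq_empty_iff[of ss chords] selected_subset[of chords ss]
    unfolding stratum_def set_chords by simp
qed

theorem live_strata: "stratum MW BW \<sigma> \<and> \<not> dead MW BW \<sigma> \<longleftrightarrow> \<sigma> \<in> supp ` set live_rows"
proof -
  have "supp ` set live_rows = selected chords ` {ss \<in> set nonempty_selections. live_row ss}"
    unfolding live_rows_correct[symmetric] by (auto simp: supp_baseline_row image_iff)
  then show ?thesis
    unfolding stratum_iff by (auto simp: dead_iff set_nonempty_selections simp del: One_nat_def)
qed

lemma dead_row_cases:
  assumes "(b, L, r) \<in> set dead_rows"
  obtains ss where "ss \<in> set nonempty_selections" "\<not> live_row ss" "baseline_row ss = b"
    "strip_while ((=) 0) (count_indep (selected_state fund_bits ss) (map polygon_bits wagner_cycles)) =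
       (if r = 0 then [1] else [1, int r + 1])"
proof -
  have "(b, if r = 0 then [1] else [1, int r + 1]) \<in>
      set (map (\<lambda>(b, L, r). (b, if r = 0 then [1] else [1, int r + 1])) dead_rows)"
    using assms by force
  then show ?thesis
    using that unfolding dead_rows_correct[symmetric] by auto
qed

theorem dead_strata:
  "stratum MW BW \<sigma> \<and> dead MW BW \<sigma> \<longleftrightarrow> \<sigma> \<in> (\<lambda>(b, L, r). supp b) ` set dead_rows"
proof -
  have "fst ` set dead_rows = set (map fst (map (\<lambda>(b, L, r). (b, if r = 0 then [1] else [1, int r + 1])) dead_rows))"
    by force
  also have "\<dots> = baseline_row ` {ss \<in> set nonempty_selections. \<not> live_row ss}"
    unfolding dead_rows_correct[symmetric] by force
  finally have "supp ` fst ` set dead_rows = selected chords ` {ss \<in> set nonempty_selections. \<not> live_row ss}"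
    by (auto simp: supp_baseline_row image_iff)
  moreover have "supp ` fst ` set dead_rows = (\<lambda>(b, L, r). supp b) ` set dead_rows"
    by force
  ultimately show ?thesis
    unfolding stratum_iff by (auto simp: dead_iff set_nonempty_selections simp del: One_nat_def)
qed

lemma baseline_supp:
  assumes "b \<in> set live_rows \<or> (b, L, r) \<in> set dead_rows"
  shows "baseline MW BW (supp b) = vec b"
proof -
  have "\<exists>ss\<in>set nonempty_selections. baseline_row ss = b"
    using assms
  proof
    assume "b \<in> set live_rows"
    then show ?thesis
      unfolding live_rows_correct[symmetric] by auto
  next
    assume "(b, L, r) \<in> set dead_rows"
    then show ?thesis
      by (rule dead_row_cases) auto
  qed
  then obtain ss where ss: "ss \<in> set nonempty_selections" "b = baseline_row ss"
    by auto
  show ?thesis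
    unfolding ss(2) supp_baseline_row[OF ss(1)]
    by (rule baseline_vec) (use ss(1) in \<open>simp add: set_nonempty_selections\<close>)
qed

text \<open>From \<open>(x - 1) + (r + 1) = x + r\<close> if \<open>K\<^sub>\<sigma>\<close> has rank 1, and from \<open>1\<close> if it has rank 0.\<close>

theorem h_vector_dead_row:
  assumes "(b, L, r) \<in> set dead_rows"
  shows "h_vector (K_matroid MW BW (supp b)) k = nth_default 0 [1, int r] k"
proof -
  obtain ss where ss: "ss \<in> set nonempty_selections" "\<not> live_row ss" "baseline_row ss = b"
    and f: "strip_while ((=) 0) (count_indep (selected_state fund_bits ss) (map polygon_bits wagner_cycles)) =
       (if r = 0 then [1] else [1, int r + 1])"
    by (rule dead_row_cases[OF assms])
  have len: "length ss = 5" using ss(1) by (simp add: set_nonempty_selections)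
  have supp: "supp b = selected chords ss"
    using supp_baseline_row[OF ss(1)] ss(3) by simp
  have fU: "forest wagner (U_set MW BW (selected chords ss))"
    using dead_iff[OF len] ss(2) unfolding dead_def indep_MW by simp
  note K = h_vector_K[OF UA_subset[OF len] fU, unfolded status_UA[OF len], OF f, of _ _ k,
    folded K_matroid_def supp]
  show ?thesis
  proof (cases "r = 0")
    case True
    have "h_vector (K_matroid MW BW (supp b)) k = nth_default 0 [1] k"
      by (rule K[of 0]) (use True in \<open>simp_all\<close>)
    then show ?thesis
      using True by (simp add: nth_default_def nth_Cons split: nat.split)
  next
    case False
    show ?thesis
      by (rule K[of 1]) (use False in \<open>simp_all add: one_pCons\<close>)
  qed
qed

section \<open>Demands on the fibres\<close>

fun leq :: "nat list \<Rightarrow> nat list \<Rightarrow> bool" where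
  "leq (x # xs) (y # ys) = (if x \<le> y then leq xs ys else False)"
| "leq _ _ = True"

text \<open>The residue at the stratum with baseline \<open>b\<close>: entries outside the stratum are those where \<open>b\<close> is zero.\<close>

definition excess :: "nat list \<Rightarrow> nat list \<Rightarrow> nat list" where
  "excess xs b = map2 (\<lambda>x y. if y = 0 then 0 else x - y) xs b"

definition unit_list :: "nat \<Rightarrow> nat list" where
  "unit_list j = (replicate 5 0)[j := 1]"

fun find_unit :: "nat list \<Rightarrow> nat list \<Rightarrow> nat option" where
  "find_unit [] d = None"
| "find_unit (j # js) d = (if d = unit_list j then Some j else find_unit js d)"

fun above_live :: "nat list list \<Rightarrow> nat list \<Rightarrow> bool" where
  "above_live [] xs = False"
| "above_live (b # bs) xs = (if leq b xs then True else above_live bs xs)"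

text \<open>A demand \<open>(b, j)\<close> says that the fibre at the stratum with baseline \<open>b\<close> must contain the unit vector in
  direction \<open>j\<close>. The value \<open>None\<close> means that no choice of fibres can satisfy the condition, since a
  residue is neither zero nor a unit vector in an admissible direction.\<close>

fun demands :: "(nat list \<times> nat list \<times> nat) list \<Rightarrow> nat list \<Rightarrow> (nat list \<times> nat) list option" where
  "demands [] xs = Some []"
| "demands ((b, L, r) # rows) xs =
     (if leq b xs then
        (if excess xs b = [0, 0, 0, 0, 0] then demands rows xs
         else (case find_unit L (excess xs b) of None \<Rightarrow> None
               | Some j \<Rightarrow> (case demands rows xs of None \<Rightarrow> None | Some ds \<Rightarrow> Some ((b, j) # ds))))
      else demands rows xs)"

definition verdict :: "nat list \<Rightarrow> (nat list \<times> nat) list option" where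
  "verdict xs = (if above_live live_rows xs then None else demands dead_rows xs)"

text \<open>All vectors of a box that are not excluded, with their demands. The box is traversed coordinate by
  coordinate instead of being built first, since rewriting would pass through that long list again
  and again.\<close>

function (sequential) accepted :: "nat list \<Rightarrow> nat list list \<Rightarrow> (nat list \<times> (nat list \<times> nat) list) list" where
  "accepted pre [] = (case verdict pre of None \<Rightarrow> [] | Some ds \<Rightarrow> [(pre, ds)])"
| "accepted pre ([] # yss) = []"
| "accepted pre ((y # ys) # yss) = accepted (pre @ [y]) yss @ accepted pre (ys # yss)"
  by pat_completeness auto
termination
  by (relation "measures [\<lambda>(pre, yss). length yss, \<lambda>(pre, yss). length (hd yss)]") auto

text \<open>The single chords are live with baselines 5, 4, 4, 5, 5, so a vector that is not excluded has smaller
  entries.\<close>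

definition box :: "nat list list" where
  "box = [[0,1,2,3,4], [0,1,2,3], [0,1,2,3], [0,1,2,3,4], [0,1,2,3,4]]"

fun increments :: "nat list \<Rightarrow> nat list list" where
  "increments [] = []"
| "increments (x # xs) = (Suc x # xs) # map (Cons x) (increments xs)"

fun covered :: "nat list \<Rightarrow> (nat list \<times> nat) list \<Rightarrow> nat list list \<Rightarrow> bool" where
  "covered xs ds [] = False"
| "covered xs ds (ys # yss) = (if verdict ys = Some ds then True else covered xs ds yss)"

fun covered_for_all :: "nat list \<Rightarrow> nat list \<Rightarrow> nat list \<Rightarrow> bool" where
  "covered_for_all xs b [] = True"
| "covered_for_all xs b (j # js) =
    (if verdict (xs[j := Suc (xs ! j)]) = Some [(b, j)] then covered_for_all xs b js else False)"

fun covered_by_row :: "nat list \<Rightarrow> (nat list \<times> nat list \<times> nat) list \<Rightarrow> bool" where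
  "covered_by_row xs [] = False"
| "covered_by_row xs ((b, L, r) # rows) =
    (if L = [] then covered_by_row xs rows
     else if covered_for_all xs b L then True else covered_by_row xs rows)"

text \<open>This is what purity requires: whichever admissible directions the fibres use, a vector of degree less
  than 7 can be increased. If every increase makes a new demand, it is enough that all the admissible
  directions of one dead stratum work, since the fibre there contains one of them.\<close>

fun cover_ok :: "nat list \<times> (nat list \<times> nat) list \<Rightarrow> bool" where
  "cover_ok (xs, ds) = (if sum_list xs = 7 then True else if 7 < sum_list xs then False
     else if covered xs ds (increments xs) then True 
     else if ds = [] then covered_by_row xs dead_rows else False)"

text \<open>Vectors are counted by degree and demands. A histogram that is updated in one pass avoids a
  traversal of the long list for each of the cells.\<close>

type_synonym cell = "nat \<times> (nat list \<times> nat) list"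

fun bump :: "cell \<Rightarrow> (cell \<times> nat) list \<Rightarrow> (cell \<times> nat) list" where
  "bump v [] = [(v, 1)]"
| "bump v ((w, n) # h) = (if v = w then (w, Suc n) # h else (w, n) # bump v h)"

fun histogram :: "(nat list \<times> (nat list \<times> nat) list) list \<Rightarrow> (cell \<times> nat) list" where
  "histogram [] = []"
| "histogram ((xs, ds) # t) = bump (sum_list xs, ds) (histogram t)"

fun multiplicity :: "(cell \<times> nat) list \<Rightarrow> cell \<Rightarrow> nat" where
  "multiplicity [] v = 0"
| "multiplicity ((w, n) # h) v = (if v = w then n else multiplicity h v)"

text \<open>This property makes the degree sequence independent of the chosen directions.\<close>

definition uniform_row :: "(cell \<times> nat) list \<Rightarrow> nat \<Rightarrow> nat list \<times> nat list \<times> nat \<Rightarrow> bool" where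
  "uniform_row t k row = (case row of (b, L, r) \<Rightarrow>
     list_all (\<lambda>n. n = multiplicity t (k, [(b, hd L)])) (map (\<lambda>j. multiplicity t (k, [(b, j)])) L))"

text \<open>By \<open>uniform_row\<close> the first direction in \<open>L\<close> may stand for each of the \<open>r\<close> chosen ones.\<close>

definition total :: "(cell \<times> nat) list \<Rightarrow> nat \<Rightarrow> nat" where
  "total t k = multiplicity t (k, []) +
     sum_list (map (\<lambda>(b, L, r). if L = [] then 0 else r * multiplicity t (k, [(b, hd L)])) dead_rows)"


fun cell :: "nat list \<times> (nat list \<times> nat) list \<Rightarrow> cell" where
  "cell (xs, ds) = (sum_list xs, ds)"

fun at_most_one_demand :: "(nat list \<times> (nat list \<times> nat) list) \<Rightarrow> bool" where
  "at_most_one_demand (xs, []) = True" | "at_most_one_demand (xs, [d]) = True" | "at_most_one_demand (xs, d # e # ds) = False"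

text \<open>Together these properties say that \<open>L\<close> consists of the directions admitted by condition (ii): adding such
  a unit vector to the baseline makes the evident demand and no other, and adding another one at the
  stratum allows a live stratum inside it to be fired. For \<open>r = 0\<close> the table has \<open>L\<close> empty by convention,
  hence the case distinction.\<close>

definition row_ok :: "nat list \<times> nat list \<times> nat \<Rightarrow> bool" where
  "row_ok row = (case row of (b, L, r) \<Rightarrow>
     length b = 5 \<and> distinct L \<and> r \<le> length L \<and> (L = [] \<longleftrightarrow> r = 0) \<and> verdict b = Some [] \<and>
     list_all (\<lambda>j. j < 5 \<and> 0 < b ! j \<and> verdict (b[j := Suc (b ! j)]) = Some [(b, j)]) L \<and>
     (r = 0 \<or> list_all (\<lambda>j. j \<in> set L \<or> b ! j = 0 \<or>
        list_ex (\<lambda>t. leq t (b[j := Suc (b ! j)]) \<and> list_all2 (\<lambda>x y. 0 < x \<longrightarrow> 0 < y) t b) live_rows)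
       [0, 1, 2, 3, 4]))"

lemma rows_ok: "list_all row_ok dead_rows"
  by code_simp

lemma live_rows_length: "list_all (\<lambda>b. length b = 5) live_rows"
  by code_simp

lemma distinct_dead_rows: "distinct (map fst dead_rows)"
  by code_simp

text \<open>The list of accepted vectors is computed once for all four checks.\<close>

lemma accepted_checks:
  "(let t = accepted [] box; h = histogram t in
     list_all cover_ok t \<and> list_all at_most_one_demand t \<and>
     list_all (\<lambda>k. list_all (uniform_row h k) dead_rows) [0, 1, 2, 3, 4, 5, 6, 7] \<and>
     map (total h) [0, 1, 2, 3, 4, 5, 6, 7] = [1, 5, 15, 35, 66, 98, 106, 66])"
  by code_simp

lemma leq_iff: "length xs = length ys \<Longrightarrow> leq xs ys \<longleftrightarrow> (\<forall>i<length xs. xs ! i \<le> ys ! i)"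
  by (induction xs ys rule: list_induct2) (auto simp: All_less_Suc2)

lemma accepted_eq:
  "accepted pre yss = concat (map (\<lambda>xs. case verdict xs of None \<Rightarrow> [] | Some ds \<Rightarrow> [(xs, ds)])
     (map ((@) pre) (product_lists yss)))"
  by (induction pre yss rule: accepted.induct) (simp_all add: comp_def)

lemma accepted_mem:
  "(xs, ds) \<in> set (accepted [] box) \<longleftrightarrow> xs \<in> set (product_lists box) \<and> verdict xs = Some ds"
  unfolding accepted_eq by (auto split: option.splits)

lemma distinct_accepted: "distinct (map fst (accepted [] box))"
proof -
  have "map fst (accepted [] box) = filter (\<lambda>xs. verdict xs \<noteq> None) (product_lists box)"
  proof -
    have "map fst (concat (map (\<lambda>xs. case verdict xs of None \<Rightarrow> [] | Some ds \<Rightarrow> [(xs, ds)]) xss)) =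
        filter (\<lambda>xs. verdict xs \<noteq> None) xss" for xss
      by (induction xss) (auto split: option.splits)
    moreover have "map ((@) []) xss = xss" for xss :: "nat list list"
      by (simp add: map_idI)
    ultimately show ?thesis
      unfolding accepted_eq by metis
  qed
  moreover have "distinct (product_lists box)"
    by (rule distinct_product_lists) (simp add: box_def)
  ultimately show ?thesis by simp
qed

lemma above_live_iff: "above_live bs xs \<longleftrightarrow> (\<exists>b\<in>set bs. leq b xs)"
  by (induction bs) auto

lemma verdict_in_box:
  assumes "length xs = 5" "verdict xs = Some ds"
  shows "xs \<in> set (product_lists box)"
proof -
  obtain p q r s t where xs: "xs = [p, q, r, s, t]"
    using assms(1) by (auto simp: numeral_eq_Suc length_Suc_conv)
  have live: "\<not> leq b xs" if "b \<in> set live_rows" for b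
    using assms(2) that unfolding verdict_def above_live_iff by (auto split: if_splits)
  have "p < 5" "q < 4" "r < 4" "s < 5" "t < 5"
    using live[of "[5,0,0,0,0]"] live[of "[0,4,0,0,0]"] live[of "[0,0,4,0,0]"]
      live[of "[0,0,0,5,0]"] live[of "[0,0,0,0,5]"]
    by (simp_all add: xs live_rows_def split: if_splits)
  then show ?thesis
    unfolding product_lists_set box_def xs by auto
qed

definition satisfies :: "(nat list \<Rightarrow> nat set) \<Rightarrow> (nat list \<times> nat) list \<Rightarrow> bool" where
  "satisfies I ds \<longleftrightarrow> (\<forall>(b, j)\<in>set ds. j \<in> I b)"

lemma unit_list_inject: "i < 5 \<Longrightarrow> j < 5 \<Longrightarrow> unit_list i = unit_list j \<longleftrightarrow> i = j"
  unfolding unit_list_def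
  by (metis length_replicate nth_list_update nth_replicate zero_neq_one)

lemma find_unit_Some: "find_unit L d = Some j \<Longrightarrow> j \<in> set L \<and> d = unit_list j"
  by (induction L) (auto split: if_splits)

lemma find_unit_None: "find_unit L d = None \<longleftrightarrow> (\<forall>j\<in>set L. d \<noteq> unit_list j)"
  by (induction L) auto

text \<open>The list of demands is met if and only if each residue is zero or a chosen unit vector.
  Distinct directions below 5 have distinct unit vectors, so the direction found in the table is the only
  candidate.\<close>

lemma demands_iff:
  assumes "\<And>b L r. (b, L, r) \<in> set rows \<Longrightarrow> I b \<subseteq> set L \<and> set L \<subseteq> {..<5}"
  shows "(\<exists>ds. demands rows xs = Some ds \<and> satisfies I ds) \<longleftrightarrow>
    (\<forall>(b, L, r)\<in>set rows. leq b xs \<longrightarrow>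
       excess xs b = [0, 0, 0, 0, 0] \<or> (\<exists>j\<in>I b. excess xs b = unit_list j))"
  using assms
proof (induction rows xs rule: demands.induct)
  case (2 b L r rows xs)
  have I: "I b \<subseteq> set L" "set L \<subseteq> {..<5}"
    using "2.prems"[of b L r] by auto
  have prems: "I b' \<subseteq> set L' \<and> set L' \<subseteq> {..<5}" if "(b', L', r') \<in> set rows" for b' L' r'
    using "2.prems"[of b' L' r'] that by simp
  show ?case
  proof (cases "leq b xs \<and> excess xs b \<noteq> [0, 0, 0, 0, 0]")
    case False
    then show ?thesis
      using "2.IH" prems by auto
  next
    case True
    show ?thesis
    proof (cases "find_unit L (excess xs b)")
      case None
      then have "\<not> (\<exists>j\<in>I b. excess xs b = unit_list j)"
        using I(1) unfolding find_unit_None by blast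
      then show ?thesis
        using True None by auto
    next
      case (Some j)
      then have j: "j \<in> set L" "excess xs b = unit_list j"
        using find_unit_Some by blast+
      then have "(\<exists>i\<in>I b. excess xs b = unit_list i) \<longleftrightarrow> j \<in> I b"
        using I unit_list_inject[of j] by (metis lessThan_iff subsetD)
      then show ?thesis
        using True Some "2.IH"(2)[OF _ _ Some] prems
        by (auto simp: satisfies_def split: option.splits)
    qed
  qed
qed (simp add: satisfies_def)

section \<open>Exponent vectors as lists\<close>

lemma dead_row_facts:
  assumes "(b, L, r) \<in> set dead_rows"
  shows "length b = 5" "distinct L" "r \<le> length L" "L = [] \<longleftrightarrow> r = 0" "verdict b = Some []"
    "\<And>j. j \<in> set L \<Longrightarrow> j < 5 \<and> 0 < b ! j \<and> verdict (b[j := Suc (b ! j)]) = Some [(b, j)]"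
    "\<And>j. 0 < r \<Longrightarrow> j < 5 \<Longrightarrow> j \<notin> set L \<Longrightarrow> 0 < b ! j \<Longrightarrow>
       \<exists>t\<in>set live_rows. leq t (b[j := Suc (b ! j)]) \<and> list_all2 (\<lambda>x y. 0 < x \<longrightarrow> 0 < y) t b"
proof -
  have ok: "row_ok (b, L, r)"
    using rows_ok assms unfolding list_all_iff by blast
  show "length b = 5" "distinct L" "r \<le> length L" "L = [] \<longleftrightarrow> r = 0" "verdict b = Some []"
    "\<And>j. j \<in> set L \<Longrightarrow> j < 5 \<and> 0 < b ! j \<and> verdict (b[j := Suc (b ! j)]) = Some [(b, j)]"
    using ok unfolding row_ok_def list_all_iff by auto
  have "r = 0 \<or> (\<forall>j\<in>set [0, 1, 2, 3, 4]. j \<in> set L \<or> b ! j = 0 \<or>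
      (\<exists>t\<in>set live_rows. leq t (b[j := Suc (b ! j)]) \<and> list_all2 (\<lambda>x y. 0 < x \<longrightarrow> 0 < y) t b))"
    using ok unfolding row_ok_def prod.case list_all_iff list_ex_iff by (elim conjE)
  moreover have "j \<in> set [0, 1, 2, 3, 4]" if "j < 5" for j :: nat
    using that by auto
  ultimately show "\<exists>t\<in>set live_rows. leq t (b[j := Suc (b ! j)]) \<and> list_all2 (\<lambda>x y. 0 < x \<longrightarrow> 0 < y) t b"
    if "0 < r" "j < 5" "j \<notin> set L" "0 < b ! j" for j
    using that by (metis less_numeral_extra(3))
qed

lemma row_length: "b \<in> set live_rows \<or> (b, L, r) \<in> set dead_rows \<Longrightarrow> length b = 5"
  using live_rows_length dead_row_facts(1) unfolding list_all_iff by blast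

lemma chord_in_supp: "length b = 5 \<Longrightarrow> i < 5 \<Longrightarrow> chords ! i \<in> supp b \<longleftrightarrow> 0 < b ! i"
  unfolding supp_def using nth_mem_selected[OF distinct_chords, of "map ((<) 0) b" i] by simp

lemma supp_subset: "supp b \<subseteq> set chords"
  unfolding supp_def by (rule selected_subset)

lemma ball_supp: "length b = 5 \<Longrightarrow> (\<forall>i\<in>supp b. P i) \<longleftrightarrow> (\<forall>i<5. 0 < b ! i \<longrightarrow> P (chords ! i))"
  using supp_subset[of b] chord_in_supp[of b]
  by (metis in_set_conv_nth length_chords nth_mem subsetD)

text \<open>Outside the stratum the baseline is zero, so nothing is required there.\<close>

lemma can_fire_supp:
  assumes "b \<in> set live_rows \<or> (b, L, r) \<in> set dead_rows" "length xs = 5"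
  shows "can_fire MW BW (vec xs) (supp b) \<longleftrightarrow> leq b xs"
proof -
  have len: "length b = 5" using row_length[OF assms(1)] .
  have "can_fire MW BW (vec xs) (supp b) \<longleftrightarrow> (\<forall>i<5. 0 < b ! i \<longrightarrow> b ! i \<le> xs ! i)"
    unfolding can_fire_def baseline_supp[OF assms(1)] ball_supp[OF len]
    using len assms(2) by (simp add: vec_nth)
  also have "\<dots> \<longleftrightarrow> leq b xs"
    using len assms(2) by (auto simp: leq_iff)
  finally show ?thesis .
qed

lemma length_excess [simp]: "length (excess xs b) = min (length xs) (length b)"
  unfolding excess_def by simp

lemma residue_supp:
  assumes "(b, L, r) \<in> set dead_rows" "length xs = 5"
  shows "residue MW BW (vec xs) (supp b) = vec (excess xs b)"
proof (rule vec_unique)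
  have len: "length b = 5" using row_length assms(1) by blast
  show "length (excess xs b) = 5" using len assms(2) by simp
  show "residue MW BW (vec xs) (supp b) e = 0" if "e \<notin> set chords" for e
    using that supp_subset[of b] unfolding residue_def by auto
  show "residue MW BW (vec xs) (supp b) (chords ! i) = excess xs b ! i" if "i < 5" for i
    unfolding residue_def baseline_supp[OF disjI2[OF assms(1)]] chord_in_supp[OF len that]
    using that len assms(2) by (simp add: vec_nth excess_def)
qed

lemma map_vec: "length xs = 5 \<Longrightarrow> map (vec xs) chords = xs"
  by (rule nth_equalityI) (simp_all add: vec_nth)

lemma vec_inject: "length xs = 5 \<Longrightarrow> length ys = 5 \<Longrightarrow> vec xs = vec ys \<longleftrightarrow> xs = ys"
  by (metis map_vec)

lemma vec_map: "a \<in> exponents (cobasis MW BW) \<Longrightarrow> vec (map a chords) = a"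
  unfolding exponents_def set_chords[symmetric] by (intro vec_unique[symmetric]) auto

lemma vec_exponents: "vec xs \<in> exponents (cobasis MW BW)"
  unfolding exponents_def set_chords[symmetric] using vec_outside by blast

lemma vec_zeros: "vec [0, 0, 0, 0, 0] = (\<lambda>_. 0)"
  by (rule vec_unique[symmetric]) (auto simp: less_Suc_eq numeral_eq_Suc)

lemma vec_unit: "j < 5 \<Longrightarrow> vec (unit_list j) = indicator_vec (chords ! j)"
  by (rule vec_unique[symmetric])
     (auto simp: unit_list_def indicator_vec_def nth_list_update nth_eq_iff_index_eq distinct_chords)

lemma sum_vec: "length xs = 5 \<Longrightarrow> sum (vec xs) (cobasis MW BW) = sum_list xs"
  unfolding set_chords[symmetric] by (metis distinct_chords map_vec sum_list_distinct_conv_sum_set)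

lemma vec_increment:
  assumes "length b = 5" "j < 5"
  shows "(\<lambda>i. vec b i + indicator_vec (chords ! j) i) = vec (b[j := Suc (b ! j)])"
proof (rule vec_unique)
  show "vec b (chords ! i) + indicator_vec (chords ! j) (chords ! i) = b[j := Suc (b ! j)] ! i"
    if "i < 5" for i
    using that assms by (cases "i = j")
      (simp_all add: vec_nth indicator_vec_def nth_eq_iff_index_eq distinct_chords)
  show "vec b e + indicator_vec (chords ! j) e = 0" if "e \<notin> set chords" for e
    using that assms by (auto simp: vec_outside indicator_vec_def)
qed (simp add: assms)

section \<open>Reading off the table of accepted vectors\<close>

lemma accepted_table_facts:
  "list_all cover_ok (accepted [] box)" "list_all at_most_one_demand (accepted [] box)"
  "list_all (\<lambda>k. list_all (uniform_row (histogram (accepted [] box)) k) dead_rows) [0, 1, 2, 3, 4, 5, 6, 7]"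
  "map (total (histogram (accepted [] box))) [0, 1, 2, 3, 4, 5, 6, 7] = [1, 5, 15, 35, 66, 98, 106, 66]"
  using accepted_checks unfolding Let_def by blast+

lemma covered_iff: "covered xs ds yss \<longleftrightarrow> (\<exists>ys\<in>set yss. verdict ys = Some ds)"
  by (induction yss) auto

lemma increments_conv: "ys \<in> set (increments xs) \<Longrightarrow> \<exists>j<length xs. ys = xs[j := Suc (xs ! j)]"
proof (induction xs arbitrary: ys)
  case (Cons x xs)
  then consider "ys = Suc x # xs" | zs where "zs \<in> set (increments xs)" "ys = x # zs"
    by auto
  then show ?case
  proof cases
    case 1
    then show ?thesis by (intro exI[of _ 0]) simp
  next
    case 2
    then obtain j where "j < length xs" "zs = xs[j := Suc (xs ! j)]"
      using Cons.IH by blast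
    then show ?thesis using 2(2) by (intro exI[of _ "Suc j"]) simp
  qed
qed simp

lemma covered_for_all_iff:
  "covered_for_all xs b L \<longleftrightarrow> (\<forall>j\<in>set L. verdict (xs[j := Suc (xs ! j)]) = Some [(b, j)])"
  by (induction L) auto

lemma covered_by_row_iff:
  "covered_by_row xs rows \<longleftrightarrow> (\<exists>(b, L, r)\<in>set rows. L \<noteq> [] \<and> covered_for_all xs b L)"
  by (induction rows) (auto split: if_splits)

lemma multiplicity_bump:
  "multiplicity (bump v h) w = (if v = w then Suc (multiplicity h w) else multiplicity h w)"
  by (induction h) auto

lemma multiplicity_histogram: "multiplicity (histogram t) v = count_list (map cell t) v"
  by (induction t rule: histogram.induct) (simp_all add: multiplicity_bump)

lemma length_filter_count:
  assumes "finite X" "\<And>v. v \<in> set vs \<Longrightarrow> P v \<Longrightarrow> v \<in> X" "\<And>v. v \<in> X \<Longrightarrow> P v"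
  shows "length (filter P vs) = (\<Sum>v\<in>X. count_list vs v)"
proof -
  have "length (filter P vs) = (\<Sum>v\<in>X. count_list (filter P vs) v)"
    using assms(1,2) by (intro sum_count_set[symmetric]) auto
  also have "count_list (filter P vs) v = count_list vs v" if "P v" for v
    using that by (induction vs) auto
  then have "(\<Sum>v\<in>X. count_list (filter P vs) v) = (\<Sum>v\<in>X. count_list vs v)"
    using assms(3) by (intro sum.cong) auto
  finally show ?thesis .
qed

lemma demands_from_rows:
  "demands rows xs = Some ds \<Longrightarrow> (b, j) \<in> set ds \<Longrightarrow> \<exists>L r. (b, L, r) \<in> set rows \<and> j \<in> set L"
proof (induction rows xs arbitrary: ds rule: demands.induct)
  case (2 b' L r rows xs)
  then show ?case
    by (fastforce split: if_splits option.splits dest: find_unit_Some)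
qed simp

lemma accepted_shape:
  assumes "(xs, ds) \<in> set (accepted [] box)" "ds \<noteq> []"
  obtains b L r j where "(b, L, r) \<in> set dead_rows" "j \<in> set L" "ds = [(b, j)]"
proof -
  have "at_most_one_demand (xs, ds)"
    using accepted_table_facts(2) assms(1) unfolding list_all_iff by blast
  then obtain b j where ds: "ds = [(b, j)]"
    using assms(2) by (cases "(xs, ds)" rule: at_most_one_demand.cases) auto
  have "demands dead_rows xs = Some ds"
    using assms(1) unfolding accepted_mem verdict_def by (auto split: if_splits)
  then show ?thesis
    using demands_from_rows[of dead_rows xs ds b j] ds that by auto
qed

section \<open>Relaxed coparking functions of a fibre system\<close>

text \<open>The condition on \<open>a\<close> in the definition of \<open>\<P>\<^sup>*(F)\<close>. For \<open>a = b\<^sub>\<sigma> + m\<close> it implies condition (ii) on the fibre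
  at \<open>\<sigma>\<close>.\<close>

definition coparks :: "(nat set set \<Rightarrow> (nat set \<Rightarrow> nat) set) \<Rightarrow> (nat set \<Rightarrow> nat) \<Rightarrow> bool" where
  "coparks F a \<longleftrightarrow> (\<forall>\<tau>. stratum MW BW \<tau> \<and> can_fire MW BW a \<tau> \<longrightarrow>
     dead MW BW \<tau> \<and> residue MW BW a \<tau> \<in> F \<tau>)"

text \<open>What is needed of a fibre system: its fibres at the dead strata are given by sets of directions of
  the right sizes. This holds for every fibre system, and it is also the starting point for
  constructing one.\<close>

locale fibre_choice =
  fixes F :: "nat set set \<Rightarrow> (nat set \<Rightarrow> nat) set" and I :: "nat list \<Rightarrow> nat set"
  assumes choice_subset: "(b, L, r) \<in> set dead_rows \<Longrightarrow> I b \<subseteq> set L"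
    and choice_card: "(b, L, r) \<in> set dead_rows \<Longrightarrow> card (I b) = r"
    and fibre_eq: "(b, L, r) \<in> set dead_rows \<Longrightarrow> F (supp b) = star ((!) chords ` I b)"
begin

lemma choice_less: "(b, L, r) \<in> set dead_rows \<Longrightarrow> j \<in> I b \<Longrightarrow> j < 5"
  using choice_subset dead_row_facts(6) by blast

lemma residue_in_fibre:
  assumes "(b, L, r) \<in> set dead_rows" "length xs = 5"
  shows "residue MW BW (vec xs) (supp b) \<in> F (supp b) \<longleftrightarrow>
    excess xs b = [0, 0, 0, 0, 0] \<or> (\<exists>j\<in>I b. excess xs b = unit_list j)"
proof -
  have len: "length (excess xs b) = 5"
    using row_length[OF disjI2[OF assms(1)]] assms(2) by simp
  have "vec (excess xs b) = indicator_vec (chords ! j) \<longleftrightarrow> excess xs b = unit_list j" if "j \<in> I b" for j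
    using len choice_less[OF assms(1) that] vec_unit[of j] vec_inject[of "excess xs b" "unit_list j"]
    by (simp add: unit_list_def)
  then show ?thesis
    unfolding residue_supp[OF assms] fibre_eq[OF assms(1)] star_def
    using len vec_inject[of "excess xs b" "[0, 0, 0, 0, 0]"] vec_zeros by auto
qed

text \<open>Live strata must not be fired, which excludes the vectors above a live baseline; dead strata
  produce the demands.\<close>

lemma coparks_vec_iff:
  assumes "length xs = 5"
  shows "coparks F (vec xs) \<longleftrightarrow> (\<exists>ds. verdict xs = Some ds \<and> satisfies I ds)"
proof -
  have "coparks F (vec xs) \<longleftrightarrow>
      (\<forall>\<tau>. stratum MW BW \<tau> \<and> \<not> dead MW BW \<tau> \<longrightarrow> \<not> can_fire MW BW (vec xs) \<tau>) \<and>
      (\<forall>\<tau>. stratum MW BW \<tau> \<and> dead MW BW \<tau> \<longrightarrow> can_fire MW BW (vec xs) \<tau> \<longrightarrow>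
         residue MW BW (vec xs) \<tau> \<in> F \<tau>)"
    unfolding coparks_def by blast
  also have "\<dots> \<longleftrightarrow> (\<forall>b\<in>set live_rows. \<not> leq b xs) \<and>
      (\<forall>(b, L, r)\<in>set dead_rows. leq b xs \<longrightarrow>
         excess xs b = [0, 0, 0, 0, 0] \<or> (\<exists>j\<in>I b. excess xs b = unit_list j))"
    unfolding live_strata dead_strata
  proof (intro arg_cong2[of _ _ _ _ "(\<and>)"])
    show "(\<forall>\<tau>. \<tau> \<in> supp ` set live_rows \<longrightarrow> \<not> can_fire MW BW (vec xs) \<tau>) \<longleftrightarrow>
        (\<forall>b\<in>set live_rows. \<not> leq b xs)"
      using can_fire_supp[OF disjI1 assms] by blast
    have *: "(\<forall>\<tau>. \<tau> \<in> (\<lambda>(b, L, r). supp b) ` set dead_rows \<longrightarrow> Q \<tau>) \<longleftrightarrow>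
        (\<forall>(b, L, r)\<in>set dead_rows. Q (supp b))" for Q
      by fastforce
    show "(\<forall>\<tau>. \<tau> \<in> (\<lambda>(b, L, r). supp b) ` set dead_rows \<longrightarrow> can_fire MW BW (vec xs) \<tau> \<longrightarrow>
         residue MW BW (vec xs) \<tau> \<in> F \<tau>) \<longleftrightarrow>
      (\<forall>(b, L, r)\<in>set dead_rows. leq b xs \<longrightarrow>
         excess xs b = [0, 0, 0, 0, 0] \<or> (\<exists>j\<in>I b. excess xs b = unit_list j))"
      unfolding *
    proof (rule ball_cong[OF refl], clarify)
      fix b L r
      assume row: "(b, L, r) \<in> set dead_rows"
      show "(can_fire MW BW (vec xs) (supp b) \<longrightarrow> residue MW BW (vec xs) (supp b) \<in> F (supp b)) \<longleftrightarrow>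
          (leq b xs \<longrightarrow> excess xs b = [0, 0, 0, 0, 0] \<or> (\<exists>j\<in>I b. excess xs b = unit_list j))"
        unfolding can_fire_supp[OF disjI2[OF row] assms] residue_in_fibre[OF row assms] ..
    qed
  qed
  also have "\<dots> \<longleftrightarrow> (\<exists>ds. verdict xs = Some ds \<and> satisfies I ds)"
  proof -
    have "I b \<subseteq> set L \<and> set L \<subseteq> {..<5}" if "(b, L, r) \<in> set dead_rows" for b L r
      using choice_subset[OF that] dead_row_facts(6)[OF that] by auto
    note demands_iff[OF this, where xs = xs, symmetric]
    then show ?thesis
      unfolding verdict_def above_live_iff by simp
  qed
  finally show ?thesis .
qed

definition coparking_lists :: "nat list set" where
  "coparking_lists = {xs. \<exists>ds. (xs, ds) \<in> set (accepted [] box) \<and> satisfies I ds}"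

lemma coparking_lists_length:
  assumes "xs \<in> coparking_lists"
  shows "length xs = 5"
proof -
  have "xs \<in> set (product_lists box)"
    using assms unfolding coparking_lists_def accepted_mem by blast
  then have "length xs = length box"
    by (rule in_set_product_lists_length)
  then show ?thesis
    by (simp add: box_def)
qed

lemma coparking_lists_iff: "length xs = 5 \<Longrightarrow> xs \<in> coparking_lists \<longleftrightarrow> coparks F (vec xs)"
  unfolding coparking_lists_def accepted_mem coparks_vec_iff using verdict_in_box by blast

theorem relaxed_coparking_eq: "relaxed_coparking MW BW F = vec ` coparking_lists"
proof
  show "relaxed_coparking MW BW F \<subseteq> vec ` coparking_lists"
  proof
    fix a
    assume "a \<in> relaxed_coparking MW BW F"
    then have a: "a \<in> exponents (cobasis MW BW)" "coparks F a"
      unfolding relaxed_coparking_def coparks_def by auto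
    then have "map a chords \<in> coparking_lists"
      using vec_map[OF a(1)] by (subst coparking_lists_iff) simp_all
    then show "a \<in> vec ` coparking_lists"
      using vec_map[OF a(1)] by (metis imageI)
  qed
  show "vec ` coparking_lists \<subseteq> relaxed_coparking MW BW F"
    using coparking_lists_length coparking_lists_iff vec_exponents
    unfolding relaxed_coparking_def coparks_def by blast
qed

lemma coparking_lists_iff_verdict:
  assumes "length xs = 5" "verdict xs = Some ds"
  shows "xs \<in> coparking_lists \<longleftrightarrow> satisfies I ds"
  using assms verdict_in_box[OF assms] unfolding coparking_lists_def accepted_mem by auto

text \<open>If the increase is possible only with a new demand at some stratum, all admissible directions there
  can be used, in particular one of the chosen directions, of which there is at least one.\<close>

lemma nonmaximal:
  assumes "xs \<in> coparking_lists" "sum_list xs \<noteq> 7"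
  shows "sum_list xs < 7" "\<exists>j<5. xs[j := Suc (xs ! j)] \<in> coparking_lists"
proof -
  have len: "length xs = 5" using coparking_lists_length[OF assms(1)] .
  obtain ds where ds: "(xs, ds) \<in> set (accepted [] box)" "satisfies I ds"
    using assms(1) unfolding coparking_lists_def by blast
  then have ok: "cover_ok (xs, ds)"
    using accepted_table_facts(1) unfolding list_all_iff by blast
  then show "sum_list xs < 7"
    using assms(2) by (auto split: if_splits)
  show "\<exists>j<5. xs[j := Suc (xs ! j)] \<in> coparking_lists"
  proof (cases "covered xs ds (increments xs)")
    case True
    then obtain j where "j < 5" "verdict (xs[j := Suc (xs ! j)]) = Some ds"
      using increments_conv len unfolding covered_iff by metis
    then show ?thesis
      using coparking_lists_iff_verdict[of "xs[j := Suc (xs ! j)]" ds] ds(2) len by auto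
  next
    case False
    then have "covered_by_row xs dead_rows"
      using ok assms(2) by (auto split: if_splits)
    then obtain b L r where row: "(b, L, r) \<in> set dead_rows" "L \<noteq> []" "covered_for_all xs b L"
      unfolding covered_by_row_iff by blast
    have "card (I b) \<noteq> 0"
      using choice_card[OF row(1)] dead_row_facts(4)[OF row(1)] row(2) by simp
    then obtain j where j: "j \<in> I b"
      by (metis card.empty ex_in_conv)
    then have "verdict (xs[j := Suc (xs ! j)]) = Some [(b, j)]"
      using row(3) choice_subset[OF row(1)] unfolding covered_for_all_iff by blast
    then have "xs[j := Suc (xs ! j)] \<in> coparking_lists"
      using coparking_lists_iff_verdict[of "xs[j := Suc (xs ! j)]" "[(b, j)]"] j len by (simp add: satisfies_def)
    then show ?thesis
      using choice_less[OF row(1) j] by blast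
  qed
qed

text \<open>A vector of degree \<open>k\<close> makes no demand or one demand \<open>(b, j)\<close>. The number of vectors in the second case is
  summed over the chosen \<open>j\<close>; as the summands do not depend on \<open>j\<close>, only the number of chosen directions
  matters.\<close>

lemma card_coparking_lists:
  "int (card {xs \<in> coparking_lists. sum_list xs = k}) = nth_default 0 [1, 5, 15, 35, 66, 98, 106, 66] k"
proof (cases "k < 8")
  case False
  have "sum_list xs \<le> 7" if "xs \<in> coparking_lists" for xs
    using nonmaximal(1)[OF that] by (cases "sum_list xs = 7") simp_all
  then have *: "{xs \<in> coparking_lists. sum_list xs = k} = {}"
    using False by fastforce
  show ?thesis
    unfolding * using False by (simp add: nth_default_def)
next
  case True
  let ?T = "accepted [] box"
  let ?cells = "map cell ?T"
  define P where "P = (\<lambda>(k', ds). k' = k \<and> satisfies I ds)"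
  define cond where "cond = (\<lambda>(b, L :: nat list, r :: nat). (\<lambda>j. (k, [(b, j)])) ` I b)"
  \<comment> \<open>The cells of degree \<open>k\<close> whose demands are met.\<close>
  let ?X = "insert (k, []) (\<Union>row\<in>set dead_rows. cond row)"
  have finI: "finite (I b)" if "(b, L, r) \<in> set dead_rows" for b L r
    using choice_subset[OF that] finite_subset by blast
  have fin: "finite (cond row)" if "row \<in> set dead_rows" for row
  proof -
    obtain b L r where row: "row = (b, L, r)" by (cases row)
    show ?thesis
      using finI[of b L r] that unfolding cond_def row by simp
  qed
  have "{xs \<in> coparking_lists. sum_list xs = k} = fst ` set (filter (P \<circ> cell) ?T)"
    unfolding coparking_lists_def P_def by (force simp: image_iff)
  also have "card \<dots> = length (map fst (filter (P \<circ> cell) ?T))"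
    using distinct_map_filter[OF distinct_accepted, of "P \<circ> cell"] distinct_card by fastforce
  also have "\<dots> = length (filter P ?cells)"
    by (simp add: filter_map)
  also have "\<dots> = (\<Sum>v\<in>?X. count_list ?cells v)"
  proof (rule length_filter_count)
    show "finite ?X" using fin by simp
    show "P v" if "v \<in> ?X" for v
      using that unfolding P_def cond_def satisfies_def by auto
    show "v \<in> ?X" if v: "v \<in> set ?cells" "P v" for v
    proof -
      obtain xs ds where xs: "(xs, ds) \<in> set ?T" "v = (sum_list xs, ds)"
        using v(1) by auto
      show ?thesis
      proof (cases "ds = []")
        case True
        then show ?thesis using v(2) xs(2) unfolding P_def by simp
      next
        case False
        then obtain b L r j where "(b, L, r) \<in> set dead_rows" "j \<in> set L" "ds = [(b, j)]"
          using accepted_shape[OF xs(1)] by blast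
        then show ?thesis
          using v(2) xs(2) unfolding P_def cond_def satisfies_def by force
      qed
    qed
  qed
  also have "\<dots> = count_list ?cells (k, []) + (\<Sum>v\<in>(\<Union>row\<in>set dead_rows. cond row). count_list ?cells v)"
    using fin by (subst sum.insert) (auto simp: cond_def)
  also have "(\<Sum>v\<in>(\<Union>row\<in>set dead_rows. cond row). count_list ?cells v) =
      (\<Sum>row\<in>set dead_rows. \<Sum>v\<in>cond row. count_list ?cells v)"
  proof (rule sum.UNION_disjoint)
    show "\<forall>row\<in>set dead_rows. \<forall>row'\<in>set dead_rows. row \<noteq> row' \<longrightarrow> cond row \<inter> cond row' = {}"
    proof (intro ballI impI)
      fix row row'
      assume *: "row \<in> set dead_rows" "row' \<in> set dead_rows" "row \<noteq> row'"
      then have "fst row \<noteq> fst row'"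
        using distinct_dead_rows by (auto simp: distinct_map dest: inj_onD)
      then show "cond row \<inter> cond row' = {}"
        unfolding cond_def by (auto split: prod.splits)
    qed
  qed (use fin in auto)
  also have "\<dots> = (\<Sum>row\<in>set dead_rows. case row of (b, L, r) \<Rightarrow>
      if L = [] then 0 else r * multiplicity (histogram ?T) (k, [(b, hd L)]))"
  proof (rule sum.cong[OF refl])
    fix row
    assume row: "row \<in> set dead_rows"
    obtain b L r where [simp]: "row = (b, L, r)" by (cases row)
    have row': "(b, L, r) \<in> set dead_rows" using row by simp
    have "k \<in> set [0, 1, 2, 3, 4, 5, 6, 7]"
      using True by auto
    then have "uniform_row (histogram ?T) k (b, L, r)"
      using accepted_table_facts(3) row' unfolding list_all_iff by blast
    then have u: "count_list ?cells (k, [(b, j)]) = multiplicity (histogram ?T) (k, [(b, hd L)])"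
      if "j \<in> set L" for j
      using that unfolding uniform_row_def list_all_iff by (auto simp: multiplicity_histogram)
    have "(\<Sum>v\<in>cond row. count_list ?cells v) = (\<Sum>j\<in>I b. count_list ?cells (k, [(b, j)]))"
      unfolding cond_def by (simp add: sum.reindex inj_on_def)
    also have "\<dots> = (\<Sum>j\<in>I b. multiplicity (histogram ?T) (k, [(b, hd L)]))"
      using u choice_subset[OF row'] by (intro sum.cong) auto
    also have "\<dots> = r * multiplicity (histogram ?T) (k, [(b, hd L)])"
      using choice_card[OF row'] by simp
    finally show "(\<Sum>v\<in>cond row. count_list ?cells v) = (case row of (b, L, r) \<Rightarrow>
        if L = [] then 0 else r * multiplicity (histogram ?T) (k, [(b, hd L)]))"
      using dead_row_facts(4)[OF row'] by simp
  qed
  also have "count_list ?cells (k, []) + \<dots> = total (histogram ?T) k"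
    unfolding total_def multiplicity_histogram[symmetric]
    using distinct_dead_rows by (simp add: sum_list_distinct_conv_sum_set distinct_map)
  finally have "card {xs \<in> coparking_lists. sum_list xs = k} = total (histogram ?T) k" .
  moreover have "map (total (histogram ?T)) [0, 1, 2, 3, 4, 5, 6, 7] ! k = [1, 5, 15, 35, 66, 98, 106, 66] ! k"
    unfolding accepted_table_facts(4) ..
  ultimately show ?thesis
    using True by (auto simp: less_Suc_eq numeral_eq_Suc nth_default_def)
qed

theorem relaxed_coparking_degree_sequence:
  "has_degree_sequence (cobasis MW BW) (relaxed_coparking MW BW F) (h_vector MW)"
  unfolding has_degree_sequence_def
proof
  fix k :: nat
  have "{a \<in> vec ` coparking_lists. sum a (cobasis MW BW) = k} = vec ` {xs \<in> coparking_lists. sum_list xs = k}"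
    using sum_vec[OF coparking_lists_length] by auto
  moreover have "inj_on vec {xs \<in> coparking_lists. sum_list xs = k}"
    by (rule inj_onI) (use vec_inject coparking_lists_length in blast)
  ultimately show "int (card {a \<in> relaxed_coparking MW BW F. sum a (cobasis MW BW) = k}) = h_vector MW k"
    unfolding relaxed_coparking_eq h_vector_MW card_coparking_lists[symmetric] by (simp only: card_image)
qed

text \<open>Closure under division holds for every choice of multicomplexes as fibres: whatever can be fired
  from a divisor of \<open>a\<close> can be fired from \<open>a\<close>, with a larger residue.\<close>

theorem relaxed_coparking_pure:
  assumes "\<And>\<tau>. stratum MW BW \<tau> \<Longrightarrow> dead MW BW \<tau> \<Longrightarrow> multicomplex \<tau> (F \<tau>)"
  shows "pure_multicomplex (cobasis MW BW) (relaxed_coparking MW BW F)"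
  unfolding pure_multicomplex_def
proof
  have fin: "finite coparking_lists"
    by (rule finite_subset[of _ "fst ` set (accepted [] box)"]) (auto simp: coparking_lists_def image_iff, force)
  show "multicomplex (cobasis MW BW) (relaxed_coparking MW BW F)"
    unfolding multicomplex_def
  proof (intro conjI ballI allI impI)
    show "finite (relaxed_coparking MW BW F)"
      unfolding relaxed_coparking_eq using fin by simp
    show "relaxed_coparking MW BW F \<subseteq> exponents (cobasis MW BW)"
      unfolding relaxed_coparking_def by (rule Collect_restrict)
    fix a b
    assume a: "a \<in> relaxed_coparking MW BW F" and b: "b \<le> a"
    have a': "a \<in> exponents (cobasis MW BW)" "coparks F a"
      using a unfolding relaxed_coparking_def coparks_def by simp_all
    have "b e = 0" if "a e = 0" for e
      using le_funD[OF b, of e] that by simp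
    then have "b \<in> exponents (cobasis MW BW)"
      using a'(1) unfolding exponents_def by simp
    moreover have "dead MW BW \<tau> \<and> residue MW BW b \<tau> \<in> F \<tau>"
      if \<tau>: "stratum MW BW \<tau>" "can_fire MW BW b \<tau>" for \<tau>
    proof -
      have "can_fire MW BW a \<tau>"
        using \<tau>(2) order_trans[OF _ le_funD[OF b]] unfolding can_fire_def by simp
      then have "dead MW BW \<tau>" "residue MW BW a \<tau> \<in> F \<tau>"
        using a'(2) \<tau>(1) unfolding coparks_def by simp_all
      moreover have "residue MW BW b \<tau> \<le> residue MW BW a \<tau>"
        using le_funD[OF b] unfolding residue_def le_fun_def by (simp add: diff_le_mono)
      ultimately show ?thesis
        using assms[OF \<tau>(1)] unfolding multicomplex_def by simp
    qed
    ultimately show "b \<in> relaxed_coparking MW BW F"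
      unfolding relaxed_coparking_def by simp
  qed
  have "sum a (cobasis MW BW) = 7" if a: "maximal_in (relaxed_coparking MW BW F) a" for a
  proof -
    obtain xs where xs: "xs \<in> coparking_lists" "a = vec xs"
      using a unfolding maximal_in_def relaxed_coparking_eq by blast
    have "sum_list xs = 7"
    proof (rule ccontr)
      assume "sum_list xs \<noteq> 7"
      then obtain j where j: "j < 5" "xs[j := Suc (xs ! j)] \<in> coparking_lists"
        using nonmaximal(2)[OF xs(1)] by blast
      let ?ys = "xs[j := Suc (xs ! j)]"
      have len: "length xs = 5" "length ?ys = 5" using coparking_lists_length[OF xs(1)] by simp_all
      have "vec xs e \<le> vec ?ys e" for e
      proof (cases "e \<in> set chords")
        case True
        then obtain i where "i < 5" "e = chords ! i"
          by (auto simp: in_set_conv_nth)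
        then show ?thesis using len by (cases "i = j") (simp_all add: vec_nth)
      qed (simp add: vec_outside)
      then have "vec xs \<le> vec ?ys"
        by (rule le_funI)
      then have "vec ?ys = vec xs"
        using a j(2) unfolding maximal_in_def relaxed_coparking_eq xs(2) by simp
      then have "?ys ! j = xs ! j"
        using vec_inject len by metis
      then show False using j(1) len by simp
    qed
    then show ?thesis
      unfolding xs(2) sum_vec[OF coparking_lists_length[OF xs(1)]] .
  qed
  then show "\<forall>a b. maximal_in (relaxed_coparking MW BW F) a \<and> maximal_in (relaxed_coparking MW BW F) b \<longrightarrow>
      sum a (cobasis MW BW) = sum b (cobasis MW BW)"
    by metis
qed

end

section \<open>Fibre systems\<close>

lemma inj_on_chords: "J \<subseteq> {..<5} \<Longrightarrow> inj_on ((!) chords) J"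
  by (rule inj_on_nth[OF distinct_chords]) auto

lemma finite_supp: "finite (supp b)"
  using finite_subset[OF supp_subset finite_set] .

lemma dead_row_stratum:
  assumes "(b, L, r) \<in> set dead_rows"
  shows "stratum MW BW (supp b)" "dead MW BW (supp b)"
  using dead_strata[of "supp b"] assms by force+

lemma live_row_stratum:
  assumes "b \<in> set live_rows"
  shows "stratum MW BW (supp b)" "\<not> dead MW BW (supp b)"
  using live_strata[of "supp b"] assms by force+

lemma supp_mono:
  assumes "length s = 5" "length t = 5" "list_all2 (\<lambda>x y. 0 < x \<longrightarrow> 0 < y) s t"
  shows "supp s \<subseteq> supp t"
proof
  fix e
  assume e: "e \<in> supp s"
  then obtain i where i: "i < 5" "e = chords ! i"
    using subsetD[OF supp_subset e] by (auto simp: in_set_conv_nth)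
  then show "e \<in> supp t"
    using e chord_in_supp[OF assms(1) i(1)] chord_in_supp[OF assms(2) i(1)]
      list_all2_nthD[OF assms(3), of i] assms(1) by simp
qed

text \<open>The degree sequence forces the fibre to be a set of unit vectors together with \<open>0\<close>. A unit vector in a
  direction that is not admissible would let a live stratum, properly contained in the dead one, be
  fired.\<close>

theorem fibre_choice_of_fibre_system:
  assumes "fibre_system MW BW F"
  shows "fibre_choice F (\<lambda>b. {j. j < 5 \<and> indicator_vec (chords ! j) \<in> F (supp b)})"
proof
  fix b L r
  assume row: "(b, L, r) \<in> set dead_rows"
  let ?I = "{j. j < 5 \<and> indicator_vec (chords ! j) \<in> F (supp b)}"
  have len: "length b = 5" using dead_row_facts(1)[OF row] .
  have base: "baseline MW BW (supp b) = vec b" using baseline_supp row by blast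
  have "fibre_at MW BW F (supp b)"
    using assms dead_row_stratum[OF row] unfolding fibre_system_def by simp
  then have mc: "multicomplex (supp b) (F (supp b))"
    and ds: "has_degree_sequence (supp b) (F (supp b)) (h_vector (K_matroid MW BW (supp b)))"
    and fires: "\<And>m \<tau>. m \<in> F (supp b) \<Longrightarrow> stratum MW BW \<tau> \<Longrightarrow> \<tau> \<subset> supp b \<Longrightarrow>
      can_fire MW BW (\<lambda>i. vec b i + m i) \<tau> \<Longrightarrow> dead MW BW \<tau>"
    unfolding fibre_at_def pure_multicomplex_def base by simp_all
  have "h_vector (K_matroid MW BW (supp b)) = nth_default 0 [1, int r]"
    using h_vector_dead_row[OF row] by (rule ext)
  note star = star_if_degree_sequence[OF finite_supp mc ds[unfolded this]]
  have in_supp: "chords ! j \<in> supp b" if "indicator_vec (chords ! j) \<in> F (supp b)" for j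
  proof (rule ccontr)
    assume "chords ! j \<notin> supp b"
    moreover have "indicator_vec (chords ! j) \<in> exponents (supp b)"
      using mc that unfolding multicomplex_def by (meson subsetD)
    ultimately have "indicator_vec (chords ! j) (chords ! j) = 0"
      unfolding exponents_def by simp
    then show False
      by (simp add: indicator_vec_def)
  qed
  have J: "{i \<in> supp b. indicator_vec i \<in> F (supp b)} = (!) chords ` ?I"
  proof
    show "(!) chords ` ?I \<subseteq> {i \<in> supp b. indicator_vec i \<in> F (supp b)}"
      using in_supp by auto
    show "{i \<in> supp b. indicator_vec i \<in> F (supp b)} \<subseteq> (!) chords ` ?I"
      using supp_subset[of b] by (auto simp: in_set_conv_nth dest!: subsetD)
  qed
  show "F (supp b) = star ((!) chords ` ?I)"
    using star(1) unfolding J .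
  have "inj_on ((!) chords) ?I"
    by (rule inj_on_chords) auto
  then show card: "card ?I = r"
    using star(2) unfolding J by (simp add: card_image)
  show "?I \<subseteq> set L"
  proof
    fix j
    assume j: "j \<in> ?I"
    show "j \<in> set L"
    proof (rule ccontr)
      assume "j \<notin> set L"
      moreover have "card ?I \<noteq> 0"
        using j by (auto simp: card_eq_0_iff)
      then have "0 < r" using card by simp
      moreover have "0 < b ! j"
        using j in_supp chord_in_supp[OF len] by blast
      ultimately obtain t where t: "t \<in> set live_rows" "leq t (b[j := Suc (b ! j)])"
        "list_all2 (\<lambda>x y. 0 < x \<longrightarrow> 0 < y) t b"
        using dead_row_facts(7)[OF row] j by blast
      have "supp t \<subseteq> supp b"
        using supp_mono[OF _ len t(3)] row_length t(1) by blast
      moreover have "supp t \<noteq> supp b"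
        using live_row_stratum(2)[OF t(1)] dead_row_stratum(2)[OF row] by metis
      moreover have "can_fire MW BW (\<lambda>i. vec b i + indicator_vec (chords ! j) i) (supp t)"
        using can_fire_supp[OF disjI1[OF t(1)], of "b[j := Suc (b ! j)]"] t(2) len j
          vec_increment[OF len, of j] by simp
      ultimately have "dead MW BW (supp t)"
        using fires[of "indicator_vec (chords ! j)" "supp t"] j live_row_stratum(1)[OF t(1)]
        by (simp add: psubsetI)
      then show False
        using live_row_stratum(2)[OF t(1)] by simp
    qed
  qed
qed

text \<open>At each dead stratum the first \<open>r\<close> of the admissible directions; any other choice would do as well.\<close>

definition first_choice :: "nat list \<Rightarrow> nat set" where
  "first_choice b = {j. \<exists>L r. (b, L, r) \<in> set dead_rows \<and> j \<in> set (take r L)}"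

definition first_fibres :: "nat set set \<Rightarrow> (nat set \<Rightarrow> nat) set" where
  "first_fibres \<sigma> = star ((!) chords ` first_choice (map (baseline MW BW \<sigma>) chords))"

lemma first_choice_row: "(b, L, r) \<in> set dead_rows \<Longrightarrow> first_choice b = set (take r L)"
  unfolding first_choice_def using eq_key_imp_eq_value[OF distinct_dead_rows] by force

lemma fibre_choice_first: "fibre_choice first_fibres first_choice"
proof
  fix b L r
  assume row: "(b, L, r) \<in> set dead_rows"
  show "first_choice b \<subseteq> set L"
    unfolding first_choice_row[OF row] by (rule set_take_subset)
  show "card (first_choice b) = r"
    unfolding first_choice_row[OF row] using dead_row_facts(2,3)[OF row] by (simp add: distinct_card)
  have "map (baseline MW BW (supp b)) chords = b"
    using baseline_supp[OF disjI2[OF row]] map_vec[OF dead_row_facts(1)[OF row]] by simp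
  then show "first_fibres (supp b) = star ((!) chords ` first_choice b)"
    unfolding first_fibres_def by simp
qed

text \<open>Condition (ii) asks that \<open>b\<^sub>\<sigma> + m\<close> satisfy the condition defining \<open>\<P>\<^sup>*(F)\<close>. By the table, this vector
  makes no demand for \<open>m = 0\<close>, and for a unit vector \<open>m\<close> in the fibre only the demand that this very fibre
  contains \<open>m\<close>.\<close>

theorem fibre_system_first: "fibre_system MW BW first_fibres"
  unfolding fibre_system_def
proof (intro allI impI)
  interpret fibre_choice first_fibres first_choice by (rule fibre_choice_first)
  fix \<sigma>
  assume "stratum MW BW \<sigma> \<and> dead MW BW \<sigma>"
  then obtain b L r where row: "(b, L, r) \<in> set dead_rows" and \<sigma>: "\<sigma> = supp b"
    unfolding dead_strata by auto
  let ?J = "(!) chords ` first_choice b"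
  have len: "length b = 5" using dead_row_facts(1)[OF row] .
  have base: "baseline MW BW (supp b) = vec b" using baseline_supp row by blast
  have F: "first_fibres \<sigma> = star ?J" unfolding \<sigma> by (rule fibre_eq[OF row])
  have J: "?J \<subseteq> \<sigma>"
  proof (rule image_subsetI)
    fix j
    assume "j \<in> first_choice b"
    then have "j \<in> set L" using choice_subset[OF row] by blast
    then show "chords ! j \<in> \<sigma>"
      unfolding \<sigma> using dead_row_facts(6)[OF row] chord_in_supp[OF len] by blast
  qed
  have "inj_on ((!) chords) (first_choice b)"
    using choice_less[OF row] by (intro inj_on_chords) auto
  then have card: "card ?J = r"
    using choice_card[OF row] by (simp add: card_image)
  have coparks: "coparks first_fibres (\<lambda>i. baseline MW BW \<sigma> i + m i)" if m: "m \<in> first_fibres \<sigma>" for m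
  proof -
    consider "m = (\<lambda>_. 0)" | j where "j \<in> first_choice b" "m = indicator_vec (chords ! j)"
      using m unfolding F star_def by blast
    then show ?thesis
    proof cases
      case 1
      then have "(\<lambda>i. baseline MW BW \<sigma> i + m i) = vec b"
        unfolding \<sigma> base by simp
      then show ?thesis
        using coparks_vec_iff[OF len] dead_row_facts(5)[OF row] by (simp add: satisfies_def)
    next
      case (2 j)
      have j: "j \<in> set L" using 2(1) choice_subset[OF row] by blast
      then have "(\<lambda>i. baseline MW BW \<sigma> i + m i) = vec (b[j := Suc (b ! j)])"
        unfolding \<sigma> base 2(2) using vec_increment[OF len] dead_row_facts(6)[OF row] by blast
      then show ?thesis
        using coparks_vec_iff[of "b[j := Suc (b ! j)]"] dead_row_facts(6)[OF row j] len 2(1)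
        by (simp add: satisfies_def)
    qed
  qed
  have h: "h_vector (K_matroid MW BW \<sigma>) = nth_default 0 [1, int (card ?J)]"
    unfolding \<sigma> card using h_vector_dead_row[OF row] by (rule ext)
  show "fibre_at MW BW first_fibres \<sigma>"
    unfolding fibre_at_def
  proof (intro conjI ballI allI impI)
    have fin: "finite \<sigma>" unfolding \<sigma> by (rule finite_supp)
    show "pure_multicomplex \<sigma> (first_fibres \<sigma>)"
      unfolding F by (rule pure_multicomplex_star[OF fin J])
    show "has_degree_sequence \<sigma> (first_fibres \<sigma>) (h_vector (K_matroid MW BW \<sigma>))"
      unfolding F h by (rule degree_sequence_star[OF fin J])
    fix m \<tau>
    assume "m \<in> first_fibres \<sigma>"
      and "stratum MW BW \<tau> \<and> \<tau> \<subset> \<sigma> \<and> can_fire MW BW (\<lambda>i. baseline MW BW \<sigma> i + m i) \<tau>"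
    then show "dead MW BW \<tau>"
      and "residue MW BW (\<lambda>i. baseline MW BW \<sigma> i + m i) \<tau> \<in> first_fibres \<tau>"
      using coparks[of m] unfolding coparks_def by simp_all
  qed
qed

theorem relaxed_coparking_of_fibre_system:
  assumes "fibre_system MW BW F"
  shows "pure_multicomplex (cobasis MW BW) (relaxed_coparking MW BW F)"
    and "has_degree_sequence (cobasis MW BW) (relaxed_coparking MW BW F) (h_vector MW)"
proof -
  interpret fibre_choice F "\<lambda>b. {j. j < 5 \<and> indicator_vec (chords ! j) \<in> F (supp b)}"
    by (rule fibre_choice_of_fibre_system[OF assms])
  show "has_degree_sequence (cobasis MW BW) (relaxed_coparking MW BW F) (h_vector MW)"
    by (rule relaxed_coparking_degree_sequence)
  show "pure_multicomplex (cobasis MW BW) (relaxed_coparking MW BW F)"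
    by (rule relaxed_coparking_pure)
      (use assms in \<open>simp add: fibre_system_def fibre_at_def pure_multicomplex_def\<close>)
qed

section \<open>The main result\<close>

text \<open>Renaming the variables of a multicomplex along a bijection preserves purity and the degree sequence.
  The maps \<open>T\<close> and \<open>S\<close> in the proof translate exponent vectors in the two directions.\<close>

lemma stanley_conjectureI:
  fixes R :: "'i set"
  assumes "finite R" "pure_multicomplex R P" "has_degree_sequence R P (h_vector M)"
  shows "stanley_conjecture_for M"
proof -
  obtain f :: "nat \<Rightarrow> 'i" where f: "bij_betw f {..<card R} R"
    using ex_bij_betw_nat_finite[OF assms(1)] atLeast0LessThan by metis
  let ?N = "{..<card R}"
  let ?g = "inv_into ?N f"
  define T where "T = (\<lambda>a j. if j \<in> ?N then a (f j) else (0 :: nat))"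
  define S where "S = (\<lambda>b i. if i \<in> R then b (?g i) else (0 :: nat))"
  have fR: "f j \<in> R" "?g (f j) = j" if "j \<in> ?N" for j
    using bij_betwE[OF f] bij_betw_inv_into_left[OF f that] that by simp_all
  have gN: "?g i \<in> ?N" "f (?g i) = i" if "i \<in> R" for i
    using bij_betwE[OF bij_betw_inv_into[OF f]] bij_betw_inv_into_right[OF f that] that by simp_all
  have ST: "S (T a) = a" if "a \<in> exponents R" for a
    using that gN unfolding S_def T_def exponents_def by fastforce
  have TS: "T (S b) = b" if "b \<in> exponents ?N" for b
    using that fR unfolding S_def T_def exponents_def by fastforce
  have mono: "T a \<le> T b" if "a \<le> b" for a b
    using that unfolding T_def le_fun_def by simp
  have monoS: "S a \<le> S b" if "a \<le> b" for a b
    using that unfolding S_def le_fun_def by simp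
  have sumT: "sum (T a) ?N = sum a R" for a
  proof -
    have "sum (T a) ?N = (\<Sum>j\<in>?N. a (f j))"
      unfolding T_def by (intro sum.cong) auto
    also have "\<dots> = sum a R"
      by (rule sum.reindex_bij_betw[OF f])
    finally show ?thesis .
  qed
  have mc: "finite P" "P \<subseteq> exponents R" "\<And>a b. a \<in> P \<Longrightarrow> b \<le> a \<Longrightarrow> b \<in> P"
    using assms(2) unfolding pure_multicomplex_def multicomplex_def by auto
  have inj: "inj_on T P"
    by (rule inj_on_inverseI[of _ S]) (use ST mc(2) in auto)
  have expT: "T a \<in> exponents ?N" for a
    unfolding T_def exponents_def by simp
  have "pure_multicomplex ?N (T ` P)"
    unfolding pure_multicomplex_def multicomplex_def
  proof (intro conjI ballI allI impI)
    show "finite (T ` P)" using mc(1) by simp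
    show "T ` P \<subseteq> exponents ?N" using expT by auto
    show "b \<in> T ` P" if ab: "a \<in> T ` P" "b \<le> a" for a b
    proof -
      obtain a' where a': "a' \<in> P" "a = T a'" using ab(1) by auto
      have "b j = 0" if "j \<notin> ?N" for j
        using le_funD[OF ab(2), of j] that unfolding a'(2) T_def by simp
      then have b: "b \<in> exponents ?N"
        unfolding exponents_def by simp
      have "S b \<le> a'"
        using monoS[OF ab(2)] ST[OF subsetD[OF mc(2) a'(1)]] unfolding a'(2) by simp
      then have "T (S b) \<in> T ` P"
        using mc(3)[OF a'(1)] by simp
      then show ?thesis
        unfolding TS[OF b] .
    qed
    have max: "maximal_in P a" if "a \<in> P" "maximal_in (T ` P) (T a)" for a
      using that inj mono unfolding maximal_in_def by (meson imageI inj_onD)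
    show "sum a ?N = sum b ?N" if ab: "maximal_in (T ` P) a \<and> maximal_in (T ` P) b" for a b
    proof -
      obtain a' b' where a': "a' \<in> P" "a = T a'" and b': "b' \<in> P" "b = T b'"
        using ab unfolding maximal_in_def by auto
      have "maximal_in P a' \<and> maximal_in P b'"
        using max[OF a'(1)] max[OF b'(1)] ab unfolding a'(2) b'(2) by simp
      then show ?thesis
        using assms(2) unfolding a'(2) b'(2) sumT pure_multicomplex_def by simp
    qed
  qed
  moreover have "has_degree_sequence ?N (T ` P) (h_vector M)"
    unfolding has_degree_sequence_def
  proof
    fix k :: nat
    have "{b \<in> T ` P. sum b ?N = k} = T ` {a \<in> P. sum a R = k}"
      using sumT by auto
    moreover have "inj_on T {a \<in> P. sum a R = k}"
      using inj by (rule inj_on_subset) auto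
    ultimately show "int (card {b \<in> T ` P. sum b ?N = k}) = h_vector M k"
      using assms(3) unfolding has_degree_sequence_def by (simp add: card_image)
  qed
  ultimately show ?thesis
    unfolding stanley_conjecture_for_def by blast
qed

text \<open>The index set of a generalized cycle system is therefore \<open>{1..5}\<close>.\<close>

lemma corank_MW: "corank MW = 5"
proof -
  have "card (edges wagner) = 12"
    unfolding set_edge_list[symmetric] using distinct_edge_list by (simp add: distinct_card)
  then show ?thesis
    unfolding corank_def using rank_MW by (simp add: ground_MW)
qed

theorem no_circuit_cycle_system:
  assumes "generalized_cycle_system MW C" "consists_of_circuits MW C"
  shows False
proof (rule no_good_five_circuits[of "{1..5}" C])
  show "circuit MW (C i)" if "i \<in> {1..5}" for i
    using assms(2) that unfolding consists_of_circuits_def corank_MW by blast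
  show "good_subfamily C T" if "T \<subseteq> {1..5}" "T \<noteq> {}" for T
    using assms(1) that unfolding generalized_cycle_system_def corank_MW good_subfamily_def by blast
qed simp_all

theorem proposition6p3:
  shows "\<not> (\<exists>C. generalized_cycle_system (graphic_matroid wagner) C \<and>
               consists_of_circuits (graphic_matroid wagner) C) \<and>
         (\<exists>F. fibre_system (graphic_matroid wagner) (canonical_tree wagner 1 0 7) F) \<and>
         (\<forall>F. fibre_system (graphic_matroid wagner) (canonical_tree wagner 1 0 7) F \<longrightarrow>
            pure_multicomplex
              (cobasis (graphic_matroid wagner) (canonical_tree wagner 1 0 7))
              (relaxed_coparking (graphic_matroid wagner) (canonical_tree wagner 1 0 7) F) \<and>
            has_degree_sequence
              (cobasis (graphic_matroid wagner) (canonical_tree wagner 1 0 7))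
              (relaxed_coparking (graphic_matroid wagner) (canonical_tree wagner 1 0 7) F)
              (h_vector (graphic_matroid wagner))) \<and>
         stanley_conjecture_for (graphic_matroid wagner)"
proof (intro conjI allI impI)
  show "\<not> (\<exists>C. generalized_cycle_system MW C \<and> consists_of_circuits MW C)"
    using no_circuit_cycle_system by metis
  show "\<exists>F. fibre_system MW BW F"
    by (rule exI[of _ first_fibres]) (rule fibre_system_first)
  show "pure_multicomplex (cobasis MW BW) (relaxed_coparking MW BW F)"
    "has_degree_sequence (cobasis MW BW) (relaxed_coparking MW BW F) (h_vector MW)"
    if "fibre_system MW BW F" for F
    by (rule relaxed_coparking_of_fibre_system[OF that])+
  show "stanley_conjecture_for MW"
    by (rule stanley_conjectureI[OF _ relaxed_coparking_of_fibre_system[OF fibre_system_first]])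
      (unfold set_chords[symmetric], rule finite_set)
qed

end
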